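(* Let $\mathcal{G}=(\mathcal{V},\mathcal{E})$ (spatial graph) and $G=(V,E)$ (opinion graph) be finite connected graphs, let $\mathbf{r}$ and $\mathbf{d}$ be the radius and diameter of $G$, and let $\epsilon(a)$ be the eccentricity of $a\in V$. Let $(\zeta_t)$ be the attraction process with confidence threshold $\tau\in\mathbb{N}$, started from an arbitrary (possibly random) initial configuration $\zeta_0$, and let $T$ be its time to fixation. Assume $\tau\in[\mathbf{r},\mathbf{d})$ and that $G$ satisfies the eccentricity inequalities $$\sum_{a'\in D(a,b)}\frac{\epsilon(a')-\epsilon(a)}{\mathrm{card}\,D(a,b)}+\sum_{b'\in D(b,a)}\frac{\epsilon(b')-\epsilon(b)}{\mathrm{card}\,D(b,a)}\le 0\quad\text{for all }a,b\in V,\ a\neq b.$$ Then $$P(\zeta_T\equiv\mathrm{cst})\ \ge\ 1-\frac{1}{\mathrm{card}(\mathcal{V})}\sum_{x\in\mathcal{V}}\left(\frac{E(\epsilon(\zeta_0(x)))-\mathbf{r}}{\tau+1-\mathbf{r}}\right).$$ In particular, if $\zeta_0$ is distributed according to the uniform product measure, then $$P(\zeta_T\equiv\mathrm{cst})\ \ge\ 1-\frac{1}{\mathrm{card}(V)}\sum_{a\in V}\left(\frac{\epsilon(a)-\mathbf{r}}{\tau+1-\mathbf{r}}\right).$$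
   Context: Graphs are simple and undirected; $\mathbb{N}=\{0,1,2,\dots\}$. $d(\cdot,\cdot)$ is the geodesic distance on the opinion graph $G$. The eccentricity of $a\in V$ is $\epsilon(a)=\max_{b\in V}d(a,b)$; $\mathbf{r}=\min_{a\in V}\epsilon(a)$ and $\mathbf{d}=\max_{a\in V}\epsilon(a)$. For $a\neq b$ in $V$, $D(a,b)=\{a'\in V:d(a,a')=1\text{ and }d(a',b)=d(a,b)-1\}$ (nonempty since $G$ is connected). Let $\vec{\mathcal{E}}$ be the set of directed edges $\vec{xy},\vec{yx}$ for $\{x,y\}\in\mathcal{E}$. The attraction process $(\zeta_t)$ is the continuous-time Markov chain on $V^{\mathcal{V}}$ (an opinion in $V$ at each vertex of $\mathcal{V}$), with right-continuous paths, in which each directed edge $\vec{xy}\in\vec{\mathcal{E}}$ becomes active at rate one, independently over directed edges and independently of $\zeta_0$. When $\vec{xy}$ becomes active and the opinions $a$ at $x$ and $b$ at $y$ satisfy $0<d(a,b)\le\tau$, the opinion at $x$ is replaced by an opinion chosen uniformly at random from $D(a,b)$; otherwise nothing changes. The time to fixation is $T=\inf\{t\ge0:\zeta_t=\zeta_s\text{ for all }s>t\}$ (with $\inf\varnothing=\infty$). The event $\{\zeta_T\equiv\mathrm{cst}\}$ is the event that $T<\infty$ and there is $c\in V$ with $\zeta_T(x)=c$ for all $x\in\mathcal{V}$. The uniform product measure is the initial distribution under which the opinions $\zeta_0(x)$, $x\in\mathcal{V}$, are independent and uniformly distributed on $V$. *)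

theory Defs
  imports "HOL-Probability.Probability"
begin

text \<open>
  A finite simple undirected graph is given by its symmetric irreflexive adjacency relation on a
  finite vertex type. The relation is then also the set of directed edges of the graph.
\<close>

definition connected_graph :: "('a::finite \<times> 'a) set \<Rightarrow> bool" where
  "connected_graph E \<longleftrightarrow> sym E \<and> irrefl E \<and> (\<forall>a b. (a, b) \<in> E\<^sup>*)"

definition gdist :: "('a \<times> 'a) set \<Rightarrow> 'a \<Rightarrow> 'a \<Rightarrow> nat" where
  "gdist E a b = (LEAST n. (a, b) \<in> E ^^ n)"

definition ecc :: "('a::finite \<times> 'a) set \<Rightarrow> 'a \<Rightarrow> nat" where
  "ecc E a = Max (range (\<lambda>b. gdist E a b))"

definition graph_radius :: "('a::finite \<times> 'a) set \<Rightarrow> nat" where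
  "graph_radius E = Min (range (ecc E))"

definition graph_diameter :: "('a::finite \<times> 'a) set \<Rightarrow> nat" where
  "graph_diameter E = Max (range (ecc E))"

definition toward :: "('a \<times> 'a) set \<Rightarrow> 'a \<Rightarrow> 'a \<Rightarrow> 'a set" where
  "toward E a b = {a'. gdist E a a' = 1 \<and> gdist E a' b + 1 = gdist E a b}"

definition eccentricity_inequalities :: "('a::finite \<times> 'a) set \<Rightarrow> bool" where
  "eccentricity_inequalities E \<longleftrightarrow> (\<forall>a b. a \<noteq> b \<longrightarrow>
     (\<Sum>a'\<in>toward E a b. (real (ecc E a') - real (ecc E a)) / real (card (toward E a b))) +
     (\<Sum>b'\<in>toward E b a. (real (ecc E b') - real (ecc E b)) / real (card (toward E b a))) \<le> 0)"

text \<open>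
  \<open>activation gap e n \<omega>\<close> is the time of the activation number \<open>n\<close> (counted from 0) of the
  directed edge \<open>e\<close>, the waiting times between its successive activations being \<open>gap e 0 \<omega>\<close>,
  \<open>gap e 1 \<omega>\<close>, and so on.
\<close>

definition activation :: "('e \<Rightarrow> nat \<Rightarrow> 'w \<Rightarrow> real) \<Rightarrow> 'e \<Rightarrow> nat \<Rightarrow> 'w \<Rightarrow> real" where
  "activation gap e n \<omega> = (\<Sum>k\<le>n. gap e k \<omega>)"

definition attraction_update ::
  "('a \<times> 'a) set \<Rightarrow> nat \<Rightarrow> 'v \<times> 'v \<Rightarrow> ('a \<Rightarrow> 'a \<Rightarrow> 'a) \<Rightarrow> ('v \<Rightarrow> 'a) \<Rightarrow> ('v \<Rightarrow> 'a)" where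
  "attraction_update E \<tau> = (\<lambda>(x, y) c \<eta>.
     if 0 < gdist E (\<eta> x) (\<eta> y) \<and> gdist E (\<eta> x) (\<eta> y) \<le> \<tau>
     then \<eta>(x := c (\<eta> x) (\<eta> y)) else \<eta>)"

datatype 'e source = Initial | Clock 'e nat | Choice 'e nat

text \<open>
  The attraction process on the spatial graph \<open>S\<close> with opinion graph \<open>E\<close>. Each directed edge has a
  clock ringing at rate one (a Poisson process, i.e. independent standard exponential waiting
  times). At activation number \<open>n\<close> of \<open>e = (x, y)\<close>, a vertex \<open>x\<close> with opinion \<open>a\<close> that is
  attracted by opinion \<open>b\<close> at \<open>y\<close> adopts \<open>choice e n \<omega> a b\<close>, which is uniform on \<open>toward E a b\<close>.
  Only one pair \<open>(a, b)\<close> is looked up per activation, so the joint law of the choices over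
  different pairs is irrelevant and left unspecified. The initial configuration, all waiting times
  and all choice functions are mutually independent.

  In \<open>evolution\<close>, if no edge is active strictly between \<open>s\<close> and \<open>t\<close>, then \<open>\<zeta> s \<omega>\<close> is the
  configuration just before \<open>t\<close>. It is an almost sure property: no meaning is given to
  simultaneous or accumulating activations, which form a null event. Right-continuity is with respect to
  the discrete topology on configurations.
\<close>

locale attraction_process = prob_space M
  for M :: "'w measure" +
  fixes S :: "('v::finite \<times> 'v) set"
    and E :: "('a::finite \<times> 'a) set"
    and \<tau> :: nat
    and gap :: "'v \<times> 'v \<Rightarrow> nat \<Rightarrow> 'w \<Rightarrow> real"
    and choice :: "'v \<times> 'v \<Rightarrow> nat \<Rightarrow> 'w \<Rightarrow> 'a \<Rightarrow> 'a \<Rightarrow> 'a"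
    and \<zeta> :: "real \<Rightarrow> 'w \<Rightarrow> 'v \<Rightarrow> 'a"
  assumes measurable_process: "\<And>t. 0 \<le> t \<Longrightarrow> \<zeta> t \<in> M \<rightarrow>\<^sub>M count_space UNIV"
    and gap_distributed: "\<And>e n. e \<in> S \<Longrightarrow> distributed M lborel (gap e n) (exponential_density 1)"
    and measurable_choice: "\<And>e n. e \<in> S \<Longrightarrow> choice e n \<in> M \<rightarrow>\<^sub>M count_space UNIV"
    and choice_uniform: "\<And>e n a b. e \<in> S \<Longrightarrow> a \<noteq> b \<Longrightarrow>
      distr M (count_space UNIV) (\<lambda>\<omega>. choice e n \<omega> a b) = measure_pmf (pmf_of_set (toward E a b))"
    and independence: "indep_sets
      (\<lambda>i. case i of
          Initial \<Rightarrow> sets (vimage_algebra (space M) (\<zeta> 0) (count_space UNIV))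
        | Clock e n \<Rightarrow> sets (vimage_algebra (space M) (gap e n) borel)
        | Choice e n \<Rightarrow> sets (vimage_algebra (space M) (choice e n) (count_space UNIV)))
      ({Initial} \<union> {Clock e n | e n. e \<in> S} \<union> {Choice e n | e n. e \<in> S})"
    and right_continuous: "\<And>\<omega> t. \<omega> \<in> space M \<Longrightarrow> 0 \<le> t \<Longrightarrow>
      (\<forall>\<^sub>F s in at_right t. \<zeta> s \<omega> = \<zeta> t \<omega>)"
    and evolution: "AE \<omega> in M. \<forall>s t. 0 \<le> s \<longrightarrow> s < t \<longrightarrow>
      (\<forall>e\<in>S. \<forall>n. activation gap e n \<omega> \<notin> {s<..<t}) \<longrightarrow>
      ((\<forall>e\<in>S. \<forall>n. activation gap e n \<omega> \<noteq> t) \<longrightarrow> \<zeta> t \<omega> = \<zeta> s \<omega>) \<and>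
      (\<forall>e\<in>S. \<forall>n. activation gap e n \<omega> = t \<longrightarrow>
         \<zeta> t \<omega> = attraction_update E \<tau> e (choice e n \<omega>) (\<zeta> s \<omega>))"

definition fixation_time :: "(real \<Rightarrow> 'w \<Rightarrow> 'c) \<Rightarrow> 'w \<Rightarrow> ereal" where
  "fixation_time \<zeta> \<omega> = Inf (ereal ` {t. 0 \<le> t \<and> (\<forall>s>t. \<zeta> t \<omega> = \<zeta> s \<omega>)})"

definition consensus_event :: "'w measure \<Rightarrow> (real \<Rightarrow> 'w \<Rightarrow> 'v \<Rightarrow> 'a) \<Rightarrow> 'w set" where
  "consensus_event M \<zeta> = {\<omega> \<in> space M. fixation_time \<zeta> \<omega> < \<infinity> \<and>
     (\<exists>c. \<forall>x. \<zeta> (real_of_ereal (fixation_time \<zeta> \<omega>)) \<omega> x = c)}"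

definition uniform_product_initial ::
  "'w measure \<Rightarrow> (real \<Rightarrow> 'w \<Rightarrow> 'v::finite \<Rightarrow> 'a::finite) \<Rightarrow> bool" where
  "uniform_product_initial M \<zeta> \<longleftrightarrow>
     prob_space.indep_vars M (\<lambda>_. count_space UNIV) (\<lambda>x \<omega>. \<zeta> 0 \<omega> x) UNIV \<and>
     (\<forall>x. distr M (count_space UNIV) (\<lambda>\<omega>. \<zeta> 0 \<omega> x) = measure_pmf (pmf_of_set UNIV))"

end

theory Submission
  imports Defs
begin

text \<open>
  By symmetry of the spatial graph, the eccentricity inequalities say that the sum of the
  eccentricities of the opinions is a supermartingale for the jump chain of the process, so
  \<open>consensus_bound\<close>, which is affine in that sum, is subharmonic. Let \<open>h \<eta>\<close> be the infimum of the
  probabilities of consensus over all attraction processes started from \<open>\<eta>\<close>. Conditioning on the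
  first active edge and on the choice made there leaves, by memorylessness of the exponential law,
  another such process started from the updated configuration; hence \<open>h\<close> is superharmonic, and
  \<open>h = 1\<close> on constant configurations.

  The maximum principle then gives \<open>consensus_bound \<le> h\<close>. Suppose that the maximum of the
  difference is positive. A maximizer has a vertex whose opinion \<open>c\<close> has eccentricity at most \<open>\<tau>\<close>,
  since otherwise \<open>consensus_bound \<le> 0 \<le> h\<close>. All opinions are within distance \<open>\<tau>\<close> of \<open>c\<close>, so
  allowed transitions lead to the constant configuration \<open>c\<close>; they remain in the set of maximizers,
  whereas \<open>consensus_bound \<le> 1 = h\<close> at the constant configuration.
  In particular, no almost sure fixation result is needed.
\<close>

section \<open>Independent families and the exponential race\<close>

abbreviation std_exponential :: "real measure" where
  "std_exponential \<equiv> density lborel (\<lambda>x. ennreal (exponential_density 1 x))"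

lemma prob_space_std_exponential: "prob_space std_exponential"
  by (rule prob_space_exponential_density) simp

text \<open>Memorylessness: after the substitution \<open>v = u + x\<close> the density splits off
  the constant \<open>exp (- u)\<close>, so survival beyond \<open>u\<close> and the residual
  \<open>v - u\<close> separate.\<close>

lemma emeasure_std_exponential_shift:
  assumes [measurable]: "A \<in> sets borel" and u: "0 \<le> u"
  shows "emeasure std_exponential {v. u < v \<and> v - u \<in> A} = ennreal (exp (- u)) * emeasure std_exponential A"
proof -
  have "emeasure std_exponential {v. u < v \<and> v - u \<in> A} =
      (\<integral>\<^sup>+x. ennreal (exponential_density 1 x) * indicator {v. u < v \<and> v - u \<in> A} x \<partial>lborel)"
    by (rule emeasure_density) auto
  also have "\<dots> = (\<integral>\<^sup>+x. ennreal (exponential_density 1 (u + x)) *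
      indicator {v. u < v \<and> v - u \<in> A} (u + x) \<partial>lborel)"
    by (subst nn_integral_real_affine[where c=1 and t=u]) auto
  also have "\<dots> = (\<integral>\<^sup>+x. ennreal (exp (- u)) * (ennreal (exponential_density 1 x) * indicator A x) \<partial>lborel)"
  proof (rule nn_integral_cong_AE)
    \<comment> \<open>At \<open>x = 0\<close> the strict inequality \<open>u < v\<close> fails while
      the density is 1, so the integrands can differ there; this point is null.\<close>
    have "AE x in lborel. x \<noteq> (0::real)" by (rule AE_lborel_singleton)
    then show "AE x in lborel. ennreal (exponential_density 1 (u + x)) *
        indicator {v. u < v \<and> v - u \<in> A} (u + x) =
        ennreal (exp (- u)) * (ennreal (exponential_density 1 x) * indicator A x)"
    proof eventually_elim
      case (elim x)
      have "exp (- u - x) = exp (- u) * exp (- x)" by (simp add: exp_diff exp_minus field_simps)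
      then show ?case
        using elim u by (auto simp: exponential_density_def ennreal_mult' split: split_indicator)
    qed
  qed
  also have "\<dots> = ennreal (exp (- u)) * emeasure std_exponential A"
    by (subst nn_integral_cmult) (auto simp: emeasure_density)
  finally show ?thesis .
qed

text \<open>The chance that \<open>n\<close> further independent clocks outlast a given one. The
  integrand times the density is \<open>1 / (1 + n)\<close> times the exponential density of rate
  \<open>1 + n\<close>.\<close>

lemma nn_integral_std_exponential_exp_power:
  "(\<integral>\<^sup>+u. ennreal (exp (- u) ^ n) \<partial>std_exponential) = ennreal (1 / (1 + real n))"
proof -
  interpret L: prob_space "density lborel (\<lambda>x. ennreal (exponential_density (1 + real n) x))"
    by (rule prob_space_exponential_density) simp
  have "(\<integral>\<^sup>+u. ennreal (exp (- u) ^ n) \<partial>std_exponential) =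
      (\<integral>\<^sup>+u. ennreal (exponential_density 1 u) * ennreal (exp (- u) ^ n) \<partial>lborel)"
    by (rule nn_integral_density) auto
  also have "\<dots> = (\<integral>\<^sup>+u. ennreal (1 / (1 + real n)) * ennreal (exponential_density (1 + real n) u) \<partial>lborel)"
  proof (rule nn_integral_cong)
    fix u :: real
    have "exp (- u) * exp (- u) ^ n = exp (- u * (1 + real n))"
      by (simp add: exp_of_nat_mult[symmetric] exp_add[symmetric] algebra_simps)
    then show "ennreal (exponential_density 1 u) * ennreal (exp (- u) ^ n) =
        ennreal (1 / (1 + real n)) * ennreal (exponential_density (1 + real n) u)"
      by (simp add: exponential_density_def ennreal_mult'[symmetric])
  qed
  also have "\<dots> = ennreal (1 / (1 + real n)) * (\<integral>\<^sup>+u. ennreal (exponential_density (1 + real n) u) \<partial>lborel)"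
    by (rule nn_integral_cmult) auto
  also have "(\<integral>\<^sup>+u. ennreal (exponential_density (1 + real n) u) \<partial>lborel) = 1"
    using L.emeasure_space_1 by (simp add: emeasure_density)
  finally show ?thesis by simp
qed

section \<open>Independent real variables with prescribed marginals\<close>

text \<open>Independence is recorded through cylinder probabilities, which can be recomputed
  directly after conditioning. The laws \<open>D i\<close> are constrained at every index, also
  outside \<open>I\<close>, so that \<open>D\<close> can be fed to
  \<open>product_prob_space\<close>.\<close>

definition product_law :: "'w measure \<Rightarrow> ('i \<Rightarrow> 'w \<Rightarrow> real) \<Rightarrow> ('i \<Rightarrow> real measure) \<Rightarrow> 'i set \<Rightarrow> bool" where
  "product_law M X D I \<longleftrightarrow> prob_space M \<and> (\<forall>i. prob_space (D i) \<and> sets (D i) = sets borel) \<and>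
     (\<forall>i\<in>I. X i \<in> borel_measurable M) \<and>
     (\<forall>J A. finite J \<longrightarrow> J \<subseteq> I \<longrightarrow> (\<forall>i\<in>J. A i \<in> sets borel) \<longrightarrow>
        measure M {\<omega> \<in> space M. \<forall>i\<in>J. X i \<omega> \<in> A i} = (\<Prod>i\<in>J. measure (D i) (A i)))"

lemma product_lawD:
  assumes "product_law M X D I"
  shows "prob_space M" "\<And>i. prob_space (D i)" "\<And>i. sets (D i) = sets borel"
    "\<And>i. i \<in> I \<Longrightarrow> X i \<in> borel_measurable M"
    "\<And>J A. finite J \<Longrightarrow> J \<subseteq> I \<Longrightarrow> (\<And>i. i \<in> J \<Longrightarrow> A i \<in> sets borel) \<Longrightarrow>
        measure M {\<omega> \<in> space M. \<forall>i\<in>J. X i \<omega> \<in> A i} = (\<Prod>i\<in>J. measure (D i) (A i))"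
  using assms unfolding product_law_def by simp_all

lemma product_law_single:
  assumes "product_law M X D I" "i \<in> I" "A \<in> sets borel"
  shows "measure M {\<omega> \<in> space M. X i \<omega> \<in> A} = measure (D i) A"
  using product_lawD(5)[OF assms(1), of "{i}" "\<lambda>_. A"] assms(2,3) by simp

lemma product_law_cong:
  assumes "product_law M X D I" "\<And>i \<omega>. i \<in> I \<Longrightarrow> X i \<omega> = Y i \<omega>"
  shows "product_law M Y D I"
proof -
  have *: "X i = Y i" if "i \<in> I" for i
    using assms(2)[OF that] by auto
  have "{\<omega> \<in> space M. \<forall>i\<in>J. X i \<omega> \<in> A i} = {\<omega> \<in> space M. \<forall>i\<in>J. Y i \<omega> \<in> A i}" if "J \<subseteq> I" for J A
    using that * by (intro Collect_cong conj_cong ball_cong) auto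
  with assms(1) * show ?thesis
    unfolding product_law_def by simp
qed

lemma product_law_reindex:
  assumes P: "product_law M X D I" and inj: "inj_on f I'" and sub: "f ` I' \<subseteq> I"
  shows "product_law M (\<lambda>i. X (f i)) (\<lambda>i. D (f i)) I'"
proof -
  have "measure M {\<omega> \<in> space M. \<forall>i\<in>J. X (f i) \<omega> \<in> A i} = (\<Prod>i\<in>J. measure (D (f i)) (A i))"
    if J: "finite J" "J \<subseteq> I'" "\<forall>i\<in>J. A i \<in> sets borel" for J A
  proof -
    have injJ: "inj_on f J" using inj J(2) by (rule inj_on_subset)
    define A' where "A' j = A (inv_into J f j)" for j
    have A': "A' (f i) = A i" if "i \<in> J" for i
      using that injJ by (simp add: A'_def)
    have "measure M {\<omega> \<in> space M. \<forall>i\<in>J. X (f i) \<omega> \<in> A i} =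
        measure M {\<omega> \<in> space M. \<forall>j\<in>f ` J. X j \<omega> \<in> A' j}"
      using A' by (auto intro!: arg_cong[where f="measure M"])
    also have "\<dots> = (\<Prod>j\<in>f ` J. measure (D j) (A' j))"
      using J sub A' by (intro product_lawD(5)[OF P]) auto
    also have "\<dots> = (\<Prod>i\<in>J. measure (D (f i)) (A i))"
      using A' by (simp add: prod.reindex[OF injJ])
    finally show ?thesis .
  qed
  with product_lawD(1-4)[OF P] sub show ?thesis
    unfolding product_law_def by blast
qed

text \<open>Rectangles determine a finite product measure, so cylinder probabilities yield the joint
  law. This makes Fubini available for the race.\<close>

lemma product_law_distr:
  assumes P: "product_law M X D I" and K: "finite K" "K \<subseteq> I"
  shows "distr M (PiM K D) (\<lambda>\<omega>. \<lambda>i\<in>K. X i \<omega>) = PiM K D"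
proof -
  interpret prob_space M by (rule product_lawD(1)[OF P])
  interpret D: product_prob_space D by (rule product_prob_spaceI) (rule product_lawD(2)[OF P])
  have XD: "X i \<in> M \<rightarrow>\<^sub>M D i" if "i \<in> K" for i
    using product_lawD(4)[OF P] product_lawD(3)[OF P] that K(2) measurable_cong_sets[OF refl] by blast
  then have meas: "(\<lambda>\<omega>. \<lambda>i\<in>K. X i \<omega>) \<in> M \<rightarrow>\<^sub>M PiM K D"
    by (intro measurable_restrict)
  show ?thesis
  proof (rule D.PiM_eqI[OF K(1)])
    fix A assume A: "\<And>i. i \<in> K \<Longrightarrow> A i \<in> sets (D i)"
    have "emeasure (distr M (PiM K D) (\<lambda>\<omega>. \<lambda>i\<in>K. X i \<omega>)) (Pi\<^sub>E K A) =
        emeasure M ((\<lambda>\<omega>. \<lambda>i\<in>K. X i \<omega>) -` Pi\<^sub>E K A \<inter> space M)"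
      using A K by (intro emeasure_distr meas sets_PiM_I_finite)
    also have "(\<lambda>\<omega>. \<lambda>i\<in>K. X i \<omega>) -` Pi\<^sub>E K A \<inter> space M = {\<omega> \<in> space M. \<forall>i\<in>K. X i \<omega> \<in> A i}"
      by (auto simp: PiE_iff)
    also have "emeasure M \<dots> = ennreal (\<Prod>i\<in>K. measure (D i) (A i))"
      unfolding emeasure_eq_measure using A product_lawD(3)[OF P] K
      by (subst product_lawD(5)[OF P]) auto
    also have "\<dots> = (\<Prod>i\<in>K. emeasure (D i) (A i))"
      by (simp add: D.M.emeasure_eq_measure prod_ennreal)
    finally show "emeasure (distr M (PiM K D) (\<lambda>\<omega>. \<lambda>i\<in>K. X i \<omega>)) (Pi\<^sub>E K A) =
      (\<Prod>i\<in>K. emeasure (D i) (A i))" .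
  qed auto
qed

text \<open>\<open>uniform_measure M H\<close> is conditioning on \<open>H\<close>. It is enough
  that each cylinder event of \<open>Y\<close> factors from \<open>H\<close>; conditioning on a
  value and conditioning on the outcome of a race are both checked in this form.\<close>

lemma product_law_uniform_measure:
  assumes P: "product_law M X D I" and H: "H \<in> sets M" "measure M H > 0"
    and Y: "\<And>i. i \<in> I' \<Longrightarrow> Y i \<in> borel_measurable M"
    and eq: "\<And>J A. finite J \<Longrightarrow> J \<subseteq> I' \<Longrightarrow> (\<And>i. i \<in> J \<Longrightarrow> A i \<in> sets borel) \<Longrightarrow>
        measure M (H \<inter> {\<omega> \<in> space M. \<forall>i\<in>J. Y i \<omega> \<in> A i}) = measure M H * (\<Prod>i\<in>J. measure (D i) (A i))"
  shows "product_law (uniform_measure M H) Y D I'"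
proof -
  interpret prob_space M by (rule product_lawD(1)[OF P])
  have H0: "emeasure M H \<noteq> 0" "emeasure M H \<noteq> \<infinity>"
    using H(2) by (auto simp: emeasure_eq_measure)
  have "measure (uniform_measure M H) {\<omega> \<in> space M. \<forall>i\<in>J. Y i \<omega> \<in> A i} =
      (\<Prod>i\<in>J. measure (D i) (A i))"
    if J: "finite J" "J \<subseteq> I'" "\<forall>i\<in>J. A i \<in> sets borel" for J A
  proof -
    have "{\<omega> \<in> space M. \<forall>i\<in>J. Y i \<omega> \<in> A i} \<in> sets M"
    proof (intro sets.sets_Collect_finite_All J(1))
      fix i assume "i \<in> J"
      then have [measurable]: "Y i \<in> borel_measurable M" "A i \<in> sets borel"
        using J Y by auto
      show "{\<omega> \<in> space M. Y i \<omega> \<in> A i} \<in> sets M" by measurable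
    qed
    then show ?thesis
      using H(2) J by (subst measure_uniform_measure[OF H0]) (simp_all add: eq)
  qed
  moreover have "Y i \<in> borel_measurable (uniform_measure M H)" if "i \<in> I'" for i
    using Y[OF that] measurable_cong_sets[of "uniform_measure M H" M borel borel] by simp
  ultimately show ?thesis
    using prob_space_uniform_measure[OF H0] product_lawD(2,3)[OF P]
    unfolding product_law_def by simp
qed

text \<open>The conditioning event is one more coordinate constraint, so the product formula on
  \<open>insert j J\<close> separates it from the others.\<close>

lemma product_law_condition:
  fixes X :: "'b \<Rightarrow> 'w \<Rightarrow> real"
  assumes P: "product_law M X D I" and j: "j \<in> I" and B: "B \<in> sets borel"
    and pos: "measure M {\<omega> \<in> space M. X j \<omega> \<in> B} > 0"
  shows "product_law (uniform_measure M {\<omega> \<in> space M. X j \<omega> \<in> B}) X D (I - {j})"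
proof (rule product_law_uniform_measure[OF P _ pos])
  note [measurable] = product_lawD(4)[OF P j] B
  show "{\<omega> \<in> space M. X j \<omega> \<in> B} \<in> sets M"
    by measurable
next
  fix J and A :: "'b \<Rightarrow> real set" assume J: "finite J" "J \<subseteq> I - {j}" "\<And>i. i \<in> J \<Longrightarrow> A i \<in> sets borel"
  have "{\<omega> \<in> space M. X j \<omega> \<in> B} \<inter> {\<omega> \<in> space M. \<forall>i\<in>J. X i \<omega> \<in> A i} =
      {\<omega> \<in> space M. \<forall>i\<in>insert j J. X i \<omega> \<in> (A(j := B)) i}"
    using J(2) by auto
  also have "measure M \<dots> = (\<Prod>i\<in>insert j J. measure (D i) ((A(j := B)) i))"
    using J j B by (intro product_lawD(5)[OF P]) auto
  also have "\<dots> = measure (D j) B * (\<Prod>i\<in>J. measure (D i) ((A(j := B)) i))"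
    using J(1,2) by (subst prod.insert) auto
  also have "(\<Prod>i\<in>J. measure (D i) ((A(j := B)) i)) = (\<Prod>i\<in>J. measure (D i) (A i))"
    using J(2) by (intro prod.cong) auto
  finally show "measure M ({\<omega> \<in> space M. X j \<omega> \<in> B} \<inter> {\<omega> \<in> space M. \<forall>i\<in>J. X i \<omega> \<in> A i}) =
      measure M {\<omega> \<in> space M. X j \<omega> \<in> B} * (\<Prod>i\<in>J. measure (D i) (A i))"
    using product_law_single[OF P j B] by simp
qed (use product_lawD(4)[OF P] in auto)

section \<open>The race of exponential clocks\<close>

text \<open>Fubini in the winning time \<open>u\<close>: by memorylessness each of the
  \<open>card F - 1\<close> losing clocks contributes a factor \<open>exp (- u)\<close> and keeps
  its law after subtraction of \<open>u\<close>, and the remaining integral in \<open>u\<close> is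
  \<open>1 / card F\<close>.\<close>

lemma product_law_race_measure:
  assumes P: "product_law M X D I" and F: "finite F" "F \<subseteq> I" "i0 \<in> F"
    and D: "\<And>i. i \<in> F \<Longrightarrow> D i = std_exponential"
    and J: "finite J" "J \<subseteq> I - {i0}" "F - {i0} \<subseteq> J" "\<And>i. i \<in> J \<Longrightarrow> A i \<in> sets borel"
  defines "B \<equiv> \<lambda>u i. if i \<in> F - {i0} then {v. u < v \<and> v - u \<in> A i} else A i"
  shows "measure M {\<omega> \<in> space M. \<forall>i\<in>J. X i \<omega> \<in> B (X i0 \<omega>) i} =
    1 / card F * (\<Prod>i\<in>J. measure (D i) (A i))"
proof -
  interpret prob_space M by (rule product_lawD(1)[OF P])
  interpret D: product_prob_space D by (rule product_prob_spaceI) (rule product_lawD(2)[OF P])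
  let ?K = "insert i0 J" and ?X = "\<lambda>\<omega>. \<lambda>i\<in>insert i0 J. X i \<omega>"
  have K: "finite ?K" "?K \<subseteq> I" and i0: "i0 \<notin> J" "i0 \<in> I" using J F by auto
  have sD [measurable_cong]: "sets (D i) = sets borel" for i by (rule product_lawD(3)[OF P])
  have spD: "space (D i) = UNIV" for i using sets_eq_imp_space_eq[OF sD] by simp
  have XD: "X i \<in> M \<rightarrow>\<^sub>M D i" if "i \<in> ?K" for i
    using product_lawD(4)[OF P] K(2) that measurable_cong_sets[OF refl sD] by blast
  have meas: "?X \<in> M \<rightarrow>\<^sub>M PiM ?K D"
    using XD by (intro measurable_restrict)
  define G where "G = {x \<in> space (PiM ?K D). \<forall>i\<in>J. x i \<in> B (x i0) i}"
  have comp: "(\<lambda>x. x i) \<in> borel_measurable (PiM ?K D)" if "i \<in> ?K" for i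
    using measurable_component_singleton[OF that, of D] measurable_cong_sets[OF refl sD] by blast
  have G: "G \<in> sets (PiM ?K D)"
    unfolding G_def
  proof (intro sets.sets_Collect_finite_All J(1))
    fix i assume i: "i \<in> J"
    note [measurable] = comp[of i] comp[of i0] J(4)[OF i]
    show "{x \<in> space (PiM ?K D). x i \<in> B (x i0) i} \<in> sets (PiM ?K D)"
      using i by (cases "i \<in> F - {i0}") (simp_all add: B_def)
  qed
  have Bm: "B u i \<in> sets (D i)" if "i \<in> J" for u i
    using J(4)[OF that] by (auto simp: B_def sD)
  have "emeasure M {\<omega> \<in> space M. \<forall>i\<in>J. X i \<omega> \<in> B (X i0 \<omega>) i} = emeasure M (?X -` G \<inter> space M)"
    by (intro arg_cong[where f="emeasure M"]) (use i0 in \<open>auto simp: G_def space_PiM spD\<close>)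
  also have "\<dots> = emeasure (distr M (PiM ?K D) ?X) G"
    by (rule emeasure_distr[symmetric, OF meas G])
  also have "\<dots> = emeasure (PiM ?K D) G"
    by (simp add: product_law_distr[OF P K])
  also have "\<dots> = (\<integral>\<^sup>+x. indicator G x \<partial>PiM ?K D)"
    using G by simp
  also have "\<dots> = (\<integral>\<^sup>+u. \<integral>\<^sup>+x. indicator G (x(i0 := u)) \<partial>PiM J D \<partial>D i0)"
    using G by (intro D.product_nn_integral_insert_rev J i0) auto
  also have "\<dots> = (\<integral>\<^sup>+u. (\<Prod>i\<in>J. emeasure (D i) (B u i)) \<partial>D i0)"
  proof (intro nn_integral_cong)
    fix u
    have "(\<integral>\<^sup>+x. indicator G (x(i0 := u)) \<partial>PiM J D) = (\<integral>\<^sup>+x. indicator (Pi\<^sub>E J (B u)) x \<partial>PiM J D)"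
      using i0 by (intro nn_integral_cong)
        (auto simp: G_def space_PiM spD PiE_iff extensional_def split: split_indicator)
    also have "\<dots> = emeasure (PiM J D) (Pi\<^sub>E J (B u))"
      using Bm J(1) by (intro nn_integral_indicator sets_PiM_I_finite)
    also have "\<dots> = (\<Prod>i\<in>J. emeasure (D i) (B u i))"
      using Bm J(1) by (intro D.emeasure_PiM)
    finally show "(\<integral>\<^sup>+x. indicator G (x(i0 := u)) \<partial>PiM J D) = (\<Prod>i\<in>J. emeasure (D i) (B u i))" .
  qed
  also have "\<dots> = (\<integral>\<^sup>+u. ennreal (exp (- u) ^ (card F - 1)) * ennreal (\<Prod>i\<in>J. measure (D i) (A i)) \<partial>D i0)"
  proof (intro nn_integral_cong_AE)
    have "AE u in D i0. 0 \<le> u"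
      unfolding D[OF F(3)] by (auto simp: AE_density exponential_density_def)
    then show "AE u in D i0. (\<Prod>i\<in>J. emeasure (D i) (B u i)) =
        ennreal (exp (- u) ^ (card F - 1)) * ennreal (\<Prod>i\<in>J. measure (D i) (A i))"
    proof eventually_elim
      case (elim u)
      have "(\<Prod>i\<in>J. emeasure (D i) (B u i)) =
          (\<Prod>i\<in>J. (if i \<in> F - {i0} then ennreal (exp (- u)) else 1) * emeasure (D i) (A i))"
        using D J(4) elim by (intro prod.cong) (auto simp: B_def emeasure_std_exponential_shift)
      also have "\<dots> = (\<Prod>i\<in>J. if i \<in> F - {i0} then ennreal (exp (- u)) else 1) *
          (\<Prod>i\<in>J. emeasure (D i) (A i))"
        by (rule prod.distrib)
      also have "(\<Prod>i\<in>J. if i \<in> F - {i0} then ennreal (exp (- u)) else 1) =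
          (\<Prod>i\<in>F - {i0}. ennreal (exp (- u)))"
        using J(1,3) by (subst prod.inter_restrict[symmetric]) (simp_all add: Int_absorb1)
      also have "\<dots> = ennreal (exp (- u) ^ (card F - 1))"
        using F by (simp add: ennreal_power)
      also have "(\<Prod>i\<in>J. emeasure (D i) (A i)) = ennreal (\<Prod>i\<in>J. measure (D i) (A i))"
        by (simp add: D.M.emeasure_eq_measure prod_ennreal)
      finally show ?case .
    qed
  qed
  also have "\<dots> = (\<integral>\<^sup>+u. ennreal (exp (- u) ^ (card F - 1)) \<partial>std_exponential) *
      ennreal (\<Prod>i\<in>J. measure (D i) (A i))"
    unfolding D[OF F(3)] by (rule nn_integral_multc) auto
  also have "\<dots> = ennreal (1 / card F * (\<Prod>i\<in>J. measure (D i) (A i)))"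
  proof -
    \<comment> \<open>\<open>i0\<close> lies in \<open>F\<close>, so the truncated difference
      \<open>card F - 1\<close> is the true number of losing clocks.\<close>
    have "card F > 0" using F by (auto simp: card_gt_0_iff)
    then have "1 + real (card F - 1) = real (card F)" by simp
    then show ?thesis
      unfolding nn_integral_std_exponential_exp_power by (simp add: ennreal_mult'[symmetric] prod_nonneg)
  qed
  finally show ?thesis
    by (simp add: emeasure_eq_measure prod_nonneg)
qed

text \<open>Given that \<open>i0\<close> wins, the residual times of the losing clocks are
  distributed like fresh clocks and stay independent of the other variables of the family. The index
  \<open>i0\<close> is dropped because its clock has been used up.\<close>

lemma product_law_race:
  assumes P: "product_law M X D I" and F: "finite F" "F \<subseteq> I" "i0 \<in> F"
    and D: "\<And>i. i \<in> F \<Longrightarrow> D i = std_exponential"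
  defines "H \<equiv> {\<omega> \<in> space M. \<forall>i\<in>F - {i0}. X i0 \<omega> < X i \<omega>}"
  shows "H \<in> sets M" "measure M H = 1 / card F"
    "product_law (uniform_measure M H)
       (\<lambda>i \<omega>. if i \<in> F - {i0} then X i \<omega> - X i0 \<omega> else X i \<omega>) D (I - {i0})" (is "product_law _ ?Y _ _")
proof -
  interpret prob_space M by (rule product_lawD(1)[OF P])
  have X [measurable]: "X i \<in> borel_measurable M" if "i \<in> I" for i
    using that by (rule product_lawD(4)[OF P])
  have Xi0: "X i0 \<in> borel_measurable M" using F by auto
  show HM: "H \<in> sets M"
    unfolding H_def
  proof (intro sets.sets_Collect_finite_All)
    fix i assume "i \<in> F - {i0}"
    then have "X i \<in> borel_measurable M" using F by auto
    then show "{\<omega> \<in> space M. X i0 \<omega> < X i \<omega>} \<in> sets M" using Xi0 by simp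
  qed (use F in auto)
  have Dp: "measure (D i) UNIV = 1" for i
    using prob_space.prob_space[OF product_lawD(2)[OF P], of i]
      sets_eq_imp_space_eq[OF product_lawD(3)[OF P], of i] by simp
  have *: "measure M (H \<inter> {\<omega> \<in> space M. \<forall>i\<in>J. ?Y i \<omega> \<in> A i}) =
      1 / card F * (\<Prod>i\<in>J. measure (D i) (A i))"
    if J: "finite J" "J \<subseteq> I - {i0}" "\<And>i. i \<in> J \<Longrightarrow> A i \<in> sets borel" for J A
  proof -
    \<comment> \<open>The race formula wants a constraint on every losing clock, so \<open>J\<close>
      is enlarged by them with the trivial set \<open>UNIV\<close>.\<close>
    let ?J = "J \<union> (F - {i0})" and ?A = "\<lambda>i. if i \<in> J then A i else UNIV"
    have "H \<inter> {\<omega> \<in> space M. \<forall>i\<in>J. ?Y i \<omega> \<in> A i} =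
        {\<omega> \<in> space M. \<forall>i\<in>?J. X i \<omega> \<in> (if i \<in> F - {i0} then {v. X i0 \<omega> < v \<and> v - X i0 \<omega> \<in> ?A i} else ?A i)}"
      unfolding H_def by (auto split: if_splits)
    also have "measure M \<dots> = 1 / card F * (\<Prod>i\<in>?J. measure (D i) (?A i))"
      using J F by (intro product_law_race_measure[OF P F D]) auto
    also have "(\<Prod>i\<in>?J. measure (D i) (?A i)) = (\<Prod>i\<in>J. measure (D i) (A i))"
      using J(1) F(1) Dp by (intro prod.mono_neutral_cong_right) auto
    finally show ?thesis .
  qed
  show mH: "measure M H = 1 / card F"
    using *[of "{}"] sets.sets_into_space[OF HM] by (simp add: Int_absorb2)
  have "card F > 0" using F by (auto simp: card_gt_0_iff)
  then show "product_law (uniform_measure M H) ?Y D (I - {i0})"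
    using * mH X Xi0 by (intro product_law_uniform_measure[OF P HM]) auto
qed

section \<open>The jump chain and the maximum principle\<close>

lemma relpow_gdist:
  assumes "connected_graph E"
  shows "(a, b) \<in> E ^^ gdist E a b"
proof -
  have "(a, b) \<in> E\<^sup>*" using assms by (simp add: connected_graph_def)
  then obtain n where "(a, b) \<in> E ^^ n" by (auto simp: rtrancl_power)
  then show ?thesis unfolding gdist_def by (rule LeastI)
qed

lemma gdist_le: "(a, b) \<in> E ^^ n \<Longrightarrow> gdist E a b \<le> n"
  unfolding gdist_def by (rule Least_le)

lemma gdist_eq_0_iff:
  assumes "connected_graph E"
  shows "gdist E a b = 0 \<longleftrightarrow> a = b"
proof
  assume "gdist E a b = 0"
  with relpow_gdist[OF assms, of a b] show "a = b" by simp
next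
  assume "a = b"
  then have "gdist E a b \<le> 0" by (intro gdist_le) simp
  then show "gdist E a b = 0" by simp
qed

lemma gdist_commute:
  assumes "connected_graph E"
  shows "gdist E a b = gdist E b a"
proof -
  have "E\<inverse> = E"
    using assms by (simp add: connected_graph_def sym_conv_converse_eq)
  then have "(E ^^ n)\<inverse> = E ^^ n" for n
    by (induction n) (simp_all add: converse_relcomp relpow_commute)
  then have "(b, a) \<in> E ^^ n \<longleftrightarrow> (a, b) \<in> E ^^ n" for n
    by (metis converse_iff)
  then show ?thesis
    by (simp add: gdist_def)
qed

lemma gdist_le_ecc: "gdist E a b \<le> ecc E a"
  unfolding ecc_def by (rule Max_ge) auto

lemma graph_radius_le_ecc: "graph_radius E \<le> ecc E a"
  unfolding graph_radius_def by (rule Min_le) auto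

text \<open>The first vertex after \<open>a\<close> on a shortest path to \<open>b\<close>
  qualifies: a shorter continuation from it would shorten the whole path.\<close>

lemma toward_nonempty:
  assumes E: "connected_graph E" and "a \<noteq> b"
  shows "toward E a b \<noteq> {}"
proof -
  have "gdist E a b \<noteq> 0" using assms by (simp add: gdist_eq_0_iff)
  then obtain n where n: "gdist E a b = Suc n" by (cases "gdist E a b") auto
  with relpow_gdist[OF E, of a b] obtain c where c: "(a, c) \<in> E" "(c, b) \<in> E ^^ n"
    by (metis relpow_Suc_D2)
  have "a \<noteq> c" using c(1) E by (auto simp: connected_graph_def irrefl_def)
  then have "gdist E a c = 1"
    using gdist_le[of a c 1 E] c(1) gdist_eq_0_iff[OF E, of a c] by force
  moreover have "gdist E c b = n"
    using gdist_le[OF c(2)] gdist_le[OF relpow_Suc_I2[OF c(1) relpow_gdist[OF E]]] n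
    by (metis Suc_le_mono antisym)
  ultimately have "c \<in> toward E a b" using n by (simp add: toward_def)
  then show ?thesis by blast
qed

section \<open>Mean one-step behaviour of the jump chain\<close>

text \<open>The expectation of \<open>f\<close> just after an activation of one given edge, with the
  random new opinion averaged out.\<close>

definition local_mean ::
  "('a::finite \<times> 'a) set \<Rightarrow> nat \<Rightarrow> (('v \<Rightarrow> 'a) \<Rightarrow> real) \<Rightarrow> ('v \<Rightarrow> 'a) \<Rightarrow> 'v \<times> 'v \<Rightarrow> real" where
  "local_mean E \<tau> f \<eta> = (\<lambda>(x, y).
     if 0 < gdist E (\<eta> x) (\<eta> y) \<and> gdist E (\<eta> x) (\<eta> y) \<le> \<tau>
     then (\<Sum>a\<in>toward E (\<eta> x) (\<eta> y). f (\<eta>(x := a))) / card (toward E (\<eta> x) (\<eta> y)) else f \<eta>)"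

text \<open>Transition operator of the jump chain embedded at the activation times.\<close>

definition jump_mean ::
  "('v::finite \<times> 'v) set \<Rightarrow> ('a::finite \<times> 'a) set \<Rightarrow> nat \<Rightarrow> (('v \<Rightarrow> 'a) \<Rightarrow> real) \<Rightarrow> ('v \<Rightarrow> 'a) \<Rightarrow> real" where
  "jump_mean S E \<tau> f \<eta> = (\<Sum>e\<in>S. local_mean E \<tau> f \<eta> e) / card S"

text \<open>The lower bound claimed for a deterministic start; being affine in the eccentricities,
  its expectation at a random start is the bound of the theorem.\<close>

definition consensus_bound :: "('a::finite \<times> 'a) set \<Rightarrow> nat \<Rightarrow> ('v::finite \<Rightarrow> 'a) \<Rightarrow> real" where
  "consensus_bound E \<tau> \<eta> = 1 - 1 / real CARD('v) *
     (\<Sum>x\<in>UNIV. (real (ecc E (\<eta> x)) - real (graph_radius E)) / (real \<tau> + 1 - real (graph_radius E)))"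

lemma consensus_bound_update:
  fixes \<eta> :: "'v::finite \<Rightarrow> 'a::finite"
  shows "consensus_bound E \<tau> (\<eta>(x := a)) = consensus_bound E \<tau> \<eta> -
    (real (ecc E a) - real (ecc E (\<eta> x))) / (real CARD('v) * (real \<tau> + 1 - real (graph_radius E)))"
proof -
  let ?w = "real \<tau> + 1 - real (graph_radius E)" and ?f = "\<lambda>a. real (ecc E a) - real (graph_radius E)"
  have "(\<Sum>z\<in>UNIV. ?f ((\<eta>(x := a)) z) / ?w) = ?f a / ?w + (\<Sum>z\<in>UNIV - {x}. ?f (\<eta> z) / ?w)"
    by (simp add: sum.remove[of UNIV x])
  moreover have "(\<Sum>z\<in>UNIV. ?f (\<eta> z) / ?w) = ?f (\<eta> x) / ?w + (\<Sum>z\<in>UNIV - {x}. ?f (\<eta> z) / ?w)"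
    by (simp add: sum.remove[of UNIV x])
  ultimately have "(\<Sum>z\<in>UNIV. ?f ((\<eta>(x := a)) z) / ?w) =
      (\<Sum>z\<in>UNIV. ?f (\<eta> z) / ?w) + (real (ecc E a) - real (ecc E (\<eta> x))) / ?w"
    by (simp add: diff_divide_distrib)
  then show ?thesis
    unfolding consensus_bound_def by (simp add: distrib_left)
qed

lemma consensus_bound_le_1:
  fixes \<eta> :: "'v::finite \<Rightarrow> 'a::finite"
  assumes "graph_radius E \<le> \<tau>"
  shows "consensus_bound E \<tau> \<eta> \<le> 1"
  using assms graph_radius_le_ecc[of E]
  unfolding consensus_bound_def by (simp add: sum_nonneg)

text \<open>An integer eccentricity above \<open>\<tau>\<close> is at least
  \<open>\<tau> + 1\<close>, so each normalized excess is at least 1. This is the origin of the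
  summand 1 in the denominator.\<close>

lemma consensus_bound_nonpos:
  fixes \<eta> :: "'v::finite \<Rightarrow> 'a::finite"
  assumes r: "graph_radius E \<le> \<tau>" and far_out: "\<And>x. \<tau> < ecc E (\<eta> x)"
  shows "consensus_bound E \<tau> \<eta> \<le> 0"
proof -
  have "1 \<le> (real (ecc E (\<eta> x)) - real (graph_radius E)) / (real \<tau> + 1 - real (graph_radius E))" for x
    using r far_out[of x] by (simp add: field_simps)
  then have "(\<Sum>x\<in>(UNIV::'v set). 1) \<le>
      (\<Sum>x\<in>UNIV. (real (ecc E (\<eta> x)) - real (graph_radius E)) / (real \<tau> + 1 - real (graph_radius E)))"
    by (intro sum_mono)
  then show ?thesis
    unfolding consensus_bound_def by (simp add: field_simps)
qed

lemma local_mean_diff: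
  "local_mean E \<tau> (\<lambda>\<eta>. f \<eta> - g \<eta>) \<eta> e = local_mean E \<tau> f \<eta> e - local_mean E \<tau> g \<eta> e"
  unfolding local_mean_def by (auto simp: sum_subtractf diff_divide_distrib split: prod.split)

lemma jump_mean_diff:
  "jump_mean S E \<tau> (\<lambda>\<eta>. f \<eta> - g \<eta>) \<eta> = jump_mean S E \<tau> f \<eta> - jump_mean S E \<tau> g \<eta>"
  unfolding jump_mean_def by (simp add: local_mean_diff sum_subtractf diff_divide_distrib)

text \<open>An activation of \<open>(x, y)\<close> can change only the eccentricity at
  \<open>x\<close>. Adding the mean changes along \<open>(x, y)\<close> and \<open>(y, x)\<close>
  gives the left-hand side of an eccentricity inequality, hence a nonpositive total.\<close>

lemma jump_mean_consensus_bound: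
  fixes \<eta> :: "'v::finite \<Rightarrow> 'a::finite"
  assumes S: "connected_graph S" "S \<noteq> {}" and E: "connected_graph E"
    and r: "graph_radius E \<le> \<tau>" and ineq: "eccentricity_inequalities E"
  shows "consensus_bound E \<tau> \<eta> \<le> jump_mean S E \<tau> (consensus_bound E \<tau>) \<eta>"
proof -
  let ?w = "real CARD('v) * (real \<tau> + 1 - real (graph_radius E))"
  have w: "?w > 0" using r by simp
  let ?act = "\<lambda>x y. 0 < gdist E (\<eta> x) (\<eta> y) \<and> gdist E (\<eta> x) (\<eta> y) \<le> \<tau>"
  \<comment> \<open>\<open>\<delta> e\<close> is the mean change of the total eccentricity at an
    activation of \<open>e\<close>, before normalization by \<open>?w\<close>.\<close>
  define \<delta> where "\<delta> = (\<lambda>(x, y). if ?act x y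
    then \<Sum>a\<in>toward E (\<eta> x) (\<eta> y). (real (ecc E a) - real (ecc E (\<eta> x))) / card (toward E (\<eta> x) (\<eta> y)) else 0)"
  have lm: "local_mean E \<tau> (consensus_bound E \<tau>) \<eta> e = consensus_bound E \<tau> \<eta> - \<delta> e / ?w" for e
  proof -
    obtain x y where e: "e = (x, y)" by (cases e)
    show ?thesis
    proof (cases "?act x y")
      case True
      then have "\<eta> x \<noteq> \<eta> y" using gdist_eq_0_iff[OF E, of "\<eta> x" "\<eta> y"] by auto
      let ?T = "toward E (\<eta> x) (\<eta> y)"
      have T: "card ?T > 0"
        using toward_nonempty[OF E \<open>\<eta> x \<noteq> \<eta> y\<close>] by (simp add: card_gt_0_iff)
      have "local_mean E \<tau> (consensus_bound E \<tau>) \<eta> e =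
          (\<Sum>a\<in>?T. consensus_bound E \<tau> \<eta> - (real (ecc E a) - real (ecc E (\<eta> x))) / ?w) / card ?T"
        using True by (simp add: local_mean_def e consensus_bound_update)
      also have "\<dots> = consensus_bound E \<tau> \<eta> - (\<Sum>a\<in>?T. real (ecc E a) - real (ecc E (\<eta> x))) / ?w / card ?T"
        using T by (simp add: sum_subtractf diff_divide_distrib sum_divide_distrib[symmetric] card_gt_0_iff)
      also have "\<dots> = consensus_bound E \<tau> \<eta> - \<delta> e / ?w"
        using True by (simp add: \<delta>_def e sum_divide_distrib[symmetric])
      finally show ?thesis .
    qed (auto simp: local_mean_def \<delta>_def e)
  qed
  have "(\<Sum>e\<in>S. \<delta> e) \<le> 0"
  proof -
    have "sym S" using S(1) by (simp add: connected_graph_def)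
    then have "(\<Sum>e\<in>S. \<delta> (prod.swap e)) = (\<Sum>e\<in>S. \<delta> e)"
      by (intro sum.reindex_bij_witness[of _ prod.swap prod.swap]) (auto dest: symD)
    then have "2 * (\<Sum>e\<in>S. \<delta> e) = (\<Sum>e\<in>S. \<delta> e + \<delta> (prod.swap e))"
      by (simp add: sum.distrib)
    also have "\<dots> \<le> 0"
    proof (intro sum_nonpos)
      fix e assume "e \<in> S"
      obtain x y where e: "e = (x, y)" by (cases e)
      \<comment> \<open>Symmetry of the distance makes both orientations of an edge allowed or both
        blocked, so the two terms of an eccentricity inequality always occur together.\<close>
      have "gdist E (\<eta> x) (\<eta> y) = gdist E (\<eta> y) (\<eta> x)" by (rule gdist_commute[OF E])
      then show "\<delta> e + \<delta> (prod.swap e) \<le> 0"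
        using ineq gdist_eq_0_iff[OF E, of "\<eta> x" "\<eta> y"]
        by (auto simp: \<delta>_def e eccentricity_inequalities_def)
    qed
    finally show ?thesis by simp
  qed
  then have "(\<Sum>e\<in>S. \<delta> e) / ?w / card S \<le> 0"
    using w by (intro divide_nonpos_nonneg) (auto intro: less_imp_le)
  moreover have "jump_mean S E \<tau> (consensus_bound E \<tau>) \<eta> =
      consensus_bound E \<tau> \<eta> - (\<Sum>e\<in>S. \<delta> e) / ?w / card S"
    using S(2) unfolding jump_mean_def lm by (simp add: sum_subtractf diff_divide_distrib sum_divide_distrib)
  ultimately show ?thesis by simp
qed

section \<open>The maximum principle\<close>

text \<open>An average of values not exceeding the maximum attains it only if each of them does.
  This is used first over the directed edges, then over the uniform choice in
  \<open>toward\<close>.\<close>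

lemma maximum_propagates:
  fixes g :: "('v::finite \<Rightarrow> 'a::finite) \<Rightarrow> real"
  assumes E: "connected_graph E" and max: "\<And>\<eta>. g \<eta> \<le> g \<eta>0" and sub: "g \<eta>0 \<le> jump_mean S E \<tau> g \<eta>0"
    and xy: "(x, y) \<in> S" and act: "0 < gdist E (\<eta>0 x) (\<eta>0 y)" "gdist E (\<eta>0 x) (\<eta>0 y) \<le> \<tau>"
    and a: "a \<in> toward E (\<eta>0 x) (\<eta>0 y)"
  shows "g (\<eta>0(x := a)) = g \<eta>0"
proof -
  have le: "local_mean E \<tau> g \<eta>0 e \<le> g \<eta>0" for e
  proof -
    obtain x y where e: "e = (x, y)" by (cases e)
    let ?T = "toward E (\<eta>0 x) (\<eta>0 y)"
    have "(\<Sum>a\<in>?T. g (\<eta>0(x := a))) \<le> real (card ?T) * g \<eta>0"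
      using sum_bounded_above[of ?T "\<lambda>a. g (\<eta>0(x := a))" "g \<eta>0"] max by simp
    moreover have "card ?T > 0" if "0 < gdist E (\<eta>0 x) (\<eta>0 y)"
      using that toward_nonempty[OF E, of "\<eta>0 x" "\<eta>0 y"] gdist_eq_0_iff[OF E, of "\<eta>0 x" "\<eta>0 y"]
      by (auto simp: card_gt_0_iff)
    ultimately show ?thesis
      by (auto simp: local_mean_def e field_simps)
  qed
  have "card S > 0" using xy by (auto simp: card_gt_0_iff)
  then have "(\<Sum>e\<in>S. g \<eta>0 - local_mean E \<tau> g \<eta>0 e) \<le> 0"
    using sub by (simp add: jump_mean_def sum_subtractf field_simps)
  moreover have "g \<eta>0 - local_mean E \<tau> g \<eta>0 (x, y) \<le> (\<Sum>e\<in>S. g \<eta>0 - local_mean E \<tau> g \<eta>0 e)"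
    using le xy by (intro member_le_sum) auto
  ultimately have eq: "local_mean E \<tau> g \<eta>0 (x, y) \<ge> g \<eta>0" by simp
  let ?T = "toward E (\<eta>0 x) (\<eta>0 y)"
  have T: "card ?T > 0" using a by (auto simp: card_gt_0_iff)
  have "(\<Sum>b\<in>?T. g \<eta>0 - g (\<eta>0(x := b))) \<le> 0"
    using eq act T by (simp add: local_mean_def sum_subtractf field_simps)
  moreover have "g \<eta>0 - g (\<eta>0(x := a)) \<le> (\<Sum>b\<in>?T. g \<eta>0 - g (\<eta>0(x := b)))"
    using a max by (intro member_le_sum) auto
  ultimately show ?thesis using max[of "\<eta>0(x := a)"] by simp
qed

text \<open>On a path from \<open>z\<close> to \<open>x0\<close> some edge leaves the set where
  \<open>P\<close> holds. Symmetry reverses it, so that the vertex \<open>x\<close> that would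
  change its opinion is the one outside.\<close>

lemma connected_boundary_edge:
  assumes "connected_graph S" "P z" "\<not> P x0"
  obtains x y where "(x, y) \<in> S" "\<not> P x" "P y"
proof -
  have "(z, x0) \<in> S\<^sup>*" using assms(1) by (simp add: connected_graph_def)
  then have "\<not> P x0 \<longrightarrow> (\<exists>x y. (x, y) \<in> S \<and> \<not> P x \<and> P y)"
  proof (induction rule: rtrancl_induct)
    case (step b c)
    have "(c, b) \<in> S" using step.hyps(2) assms(1) by (auto simp: connected_graph_def dest: symD)
    then show ?case using step.IH by blast
  qed (use assms(2) in simp)
  then show ?thesis using assms(3) that by blast
qed

lemma consensus_bound_le_superharmonic:
  fixes h :: "('v::finite \<Rightarrow> 'a::finite) \<Rightarrow> real"
  assumes S: "connected_graph S" and E: "connected_graph E"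
    and r: "graph_radius E \<le> \<tau>" and ineq: "eccentricity_inequalities E"
    and nonneg: "\<And>\<eta>. 0 \<le> h \<eta>" and one: "\<And>c. 1 \<le> h (\<lambda>_. c)"
    and super: "\<And>\<eta>. jump_mean S E \<tau> h \<eta> \<le> h \<eta>"
  shows "consensus_bound E \<tau> \<eta> \<le> h \<eta>"
proof (rule ccontr)
  assume neg: "\<not> consensus_bound E \<tau> \<eta> \<le> h \<eta>"
  define g where "g \<eta> = consensus_bound E \<tau> \<eta> - h \<eta>" for \<eta>
  define m where "m = Max (range g)"
  have max: "g \<eta> \<le> m" for \<eta> unfolding m_def by (rule Max_ge) auto
  have "m > 0" using max[of \<eta>] neg by (simp add: g_def)
  have "m \<in> range g" unfolding m_def by (rule Max_in) auto
  then obtain \<eta>0 where \<eta>0: "g \<eta>0 = m" by auto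
  have "\<not> consensus_bound E \<tau> \<eta>0 \<le> 0"
    using \<eta>0 \<open>m > 0\<close> nonneg[of \<eta>0] by (simp add: g_def)
  then obtain z where z: "ecc E (\<eta>0 z) \<le> \<tau>"
    using consensus_bound_nonpos[OF r, of \<eta>0] by (meson not_less)
  define c where "c = \<eta>0 z"
  \<comment> \<open>Total distance to consensus at \<open>c\<close>. Among the maximizers that keep
    \<open>c\<close> at \<open>z\<close>, one of least \<open>\<Psi>\<close> is taken, to be
    contradicted by a further move.\<close>
  define \<Psi> where "\<Psi> \<xi> = (\<Sum>x\<in>UNIV. gdist E (\<xi> x) c)" for \<xi> :: "'v \<Rightarrow> 'a"
  obtain \<xi> where \<xi>: "g \<xi> = m" "\<xi> z = c" and least: "\<And>\<xi>'. g \<xi>' = m \<Longrightarrow> \<xi>' z = c \<Longrightarrow> \<Psi> \<xi> \<le> \<Psi> \<xi>'"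
    using ex_has_least_nat[of "\<lambda>\<xi>. g \<xi> = m \<and> \<xi> z = c" \<eta>0 \<Psi>] \<eta>0 c_def by auto
  show False
  proof (cases "\<forall>x. \<xi> x = c")
    case True
    then have "\<xi> = (\<lambda>_. c)" by auto
    then have "g \<xi> \<le> 0"
      using one[of c] consensus_bound_le_1[OF r, of \<xi>] by (simp add: g_def)
    with \<xi>(1) \<open>m > 0\<close> show False by simp
  next
    case False
    then obtain x0 where "\<xi> x0 \<noteq> c" by auto
    then obtain x y where xy: "(x, y) \<in> S" "\<xi> x \<noteq> c" "\<xi> y = c"
      using connected_boundary_edge[OF S, of "\<lambda>x. \<xi> x = c" z x0] \<xi>(2) by blast
    then have "S \<noteq> {}" by auto
    obtain a where a: "a \<in> toward E (\<xi> x) (\<xi> y)"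
      using toward_nonempty[OF E, of "\<xi> x" "\<xi> y"] xy by auto
    \<comment> \<open>The eccentricity of \<open>c\<close> is at most \<open>\<tau>\<close>, so the
      confidence threshold never blocks an edge towards a vertex holding \<open>c\<close>.\<close>
    have act: "0 < gdist E (\<xi> x) (\<xi> y)" "gdist E (\<xi> x) (\<xi> y) \<le> \<tau>"
      using xy gdist_eq_0_iff[OF E, of "\<xi> x" c] gdist_commute[OF E, of "\<xi> x" c]
        gdist_le_ecc[of E c "\<xi> x"] z by (auto simp: c_def)
    have "g \<xi> \<le> jump_mean S E \<tau> g \<xi>"
      using jump_mean_consensus_bound[OF S \<open>S \<noteq> {}\<close> E r ineq, of \<xi>] super[of \<xi>]
      unfolding g_def jump_mean_diff by simp
    then have "g (\<xi>(x := a)) = m"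
      using maximum_propagates[OF E _ _ xy(1) act a, of g] max \<xi>(1) by simp
    \<comment> \<open>\<open>z\<close> holds \<open>c\<close> and \<open>x\<close> does not, so
      \<open>z\<close> is not the updated vertex.\<close>
    moreover have "(\<xi>(x := a)) z = c" using xy \<xi>(2) by auto
    ultimately have "\<Psi> \<xi> \<le> \<Psi> (\<xi>(x := a))" by (rule least)
    moreover have "\<Psi> (\<xi>(x := a)) < \<Psi> \<xi>"
    proof -
      have "gdist E a c + 1 = gdist E (\<xi> x) c" using a xy by (simp add: toward_def)
      then show ?thesis
        unfolding \<Psi>_def by (intro sum_strict_mono_ex1) auto
    qed
    ultimately show False by simp
  qed
qed

section \<open>Paths and systems\<close>

text \<open>The almost sure evolution property at a fixed sample point, which allows deterministic
  arguments on single paths.\<close>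

definition evolves ::
  "('v \<times> 'v) set \<Rightarrow> ('a \<times> 'a) set \<Rightarrow> nat \<Rightarrow> ('v \<times> 'v \<Rightarrow> nat \<Rightarrow> 'w \<Rightarrow> real) \<Rightarrow>
   ('v \<times> 'v \<Rightarrow> nat \<Rightarrow> 'w \<Rightarrow> 'a \<Rightarrow> 'a \<Rightarrow> 'a) \<Rightarrow> (real \<Rightarrow> 'w \<Rightarrow> 'v \<Rightarrow> 'a) \<Rightarrow> 'w \<Rightarrow> bool" where
  "evolves S E \<tau> gap choice \<zeta> \<omega> \<longleftrightarrow> (\<forall>s t. 0 \<le> s \<longrightarrow> s < t \<longrightarrow>
      (\<forall>e\<in>S. \<forall>n. activation gap e n \<omega> \<notin> {s<..<t}) \<longrightarrow>
      ((\<forall>e\<in>S. \<forall>n. activation gap e n \<omega> \<noteq> t) \<longrightarrow> \<zeta> t \<omega> = \<zeta> s \<omega>) \<and>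
      (\<forall>e\<in>S. \<forall>n. activation gap e n \<omega> = t \<longrightarrow>
         \<zeta> t \<omega> = attraction_update E \<tau> e (choice e n \<omega>) (\<zeta> s \<omega>)))"

lemma activation_0 [simp]: "activation gap e 0 \<omega> = gap e 0 \<omega>"
  by (simp add: activation_def)

lemma activation_Suc [simp]: "activation gap e (Suc n) \<omega> = activation gap e n \<omega> + gap e (Suc n) \<omega>"
  by (simp add: activation_def)

lemma activation_mono:
  assumes "\<And>n. 0 < gap e n \<omega>" "m \<le> n"
  shows "activation gap e m \<omega> \<le> activation gap e n \<omega>"
  using assms(2)
proof (induction n rule: dec_induct)
  case (step n)
  then show ?case using assms(1)[of "Suc n"] by simp
qed simp

text \<open>The clocks seen from the instant at which \<open>e\<close> is the first edge to ring.\<close>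

definition gap_after :: "'e \<Rightarrow> ('e \<Rightarrow> nat \<Rightarrow> 'w \<Rightarrow> real) \<Rightarrow> 'e \<Rightarrow> nat \<Rightarrow> 'w \<Rightarrow> real" where
  "gap_after e gap e' n \<omega> = (if e' = e then gap e (Suc n) \<omega>
     else if n = 0 then gap e' 0 \<omega> - gap e 0 \<omega> else gap e' n \<omega>)"

definition choice_after :: "'e \<Rightarrow> ('e \<Rightarrow> nat \<Rightarrow> 'b) \<Rightarrow> 'e \<Rightarrow> nat \<Rightarrow> 'b" where
  "choice_after e choice e' n = choice e' (if e' = e then Suc n else n)"

lemma activation_gap_after:
  "activation (gap_after e gap) e' n \<omega> = activation gap e' (if e' = e then Suc n else n) \<omega> - gap e 0 \<omega>"
  by (induction n) (auto simp: gap_after_def)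

text \<open>Gaps are positive, so each edge's later activations follow its first one and no
  activation lies strictly between time 0 and the first ring; the configuration just before that
  ring is the initial one.\<close>

lemma evolves_first:
  assumes ev: "evolves S E \<tau> gap choice \<zeta> \<omega>" and e: "e \<in> S"
    and pos: "\<And>e n. e \<in> S \<Longrightarrow> 0 < gap e n \<omega>"
    and first: "\<And>e'. e' \<in> S \<Longrightarrow> e' \<noteq> e \<Longrightarrow> gap e 0 \<omega> < gap e' 0 \<omega>"
  shows "\<zeta> (gap e 0 \<omega>) \<omega> = attraction_update E \<tau> e (choice e 0 \<omega>) (\<zeta> 0 \<omega>)"
proof -
  have "activation gap e' n \<omega> \<notin> {0<..<gap e 0 \<omega>}" if "e' \<in> S" for e' n
    using activation_mono[of gap e' \<omega> 0 n] pos[OF that] first[OF that] by (cases "e' = e") auto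
  then show ?thesis
    using ev e pos[OF e, of 0] activation_0[of gap e \<omega>] unfolding evolves_def
    by (metis order_refl)
qed

text \<open>Shifting time by the first ring removes activation number 0 of \<open>e\<close> and
  keeps all others. The removed one falls at the new time 0, which lies in no
  \<open>{s<..<t}\<close> with \<open>0 \<le> s\<close> and differs from every such
  \<open>t\<close>.\<close>

lemma evolves_after:
  assumes ev: "evolves S E \<tau> gap choice \<zeta> \<omega>" and e: "e \<in> S" and pos: "0 < gap e 0 \<omega>"
  shows "evolves S E \<tau> (gap_after e gap) (choice_after e choice) (\<lambda>t \<omega>. \<zeta> (\<bar>gap e 0 \<omega>\<bar> + t) \<omega>) \<omega>"
  unfolding evolves_def
proof (intro allI impI)
  fix s t :: real
  assume st: "0 \<le> s" "s < t"
    and none: "\<forall>e'\<in>S. \<forall>n. activation (gap_after e gap) e' n \<omega> \<notin> {s<..<t}"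
  let ?u = "gap e 0 \<omega>"
  have split: "(e' = e \<and> n = 0) \<or> (\<exists>m. n = (if e' = e then Suc m else m))" for e' n
    by (cases n) auto
  have none': "activation gap e' n \<omega> \<notin> {?u + s<..<?u + t}" if "e' \<in> S" for e' n
    using split[of e' n]
  proof (elim disjE exE)
    fix m assume "n = (if e' = e then Suc m else m)"
    with bspec[OF none that, rule_format, of m] show ?thesis
      by (auto simp: activation_gap_after)
  qed (use st in simp)
  have *: "((\<forall>e\<in>S. \<forall>n. activation gap e n \<omega> \<noteq> ?u + t) \<longrightarrow> \<zeta> (?u + t) \<omega> = \<zeta> (?u + s) \<omega>) \<and>
      (\<forall>e\<in>S. \<forall>n. activation gap e n \<omega> = ?u + t \<longrightarrow>
         \<zeta> (?u + t) \<omega> = attraction_update E \<tau> e (choice e n \<omega>) (\<zeta> (?u + s) \<omega>))"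
    using ev[unfolded evolves_def, rule_format, of "?u + s" "?u + t"] none' st pos by simp
  have 1: "\<zeta> (?u + t) \<omega> = \<zeta> (?u + s) \<omega>"
    if no: "\<forall>e'\<in>S. \<forall>n. activation (gap_after e gap) e' n \<omega> \<noteq> t"
  proof -
    have "activation gap e' n \<omega> \<noteq> ?u + t" if "e' \<in> S" for e' n
      using split[of e' n]
    proof (elim disjE exE)
      fix m assume "n = (if e' = e then Suc m else m)"
      with bspec[OF no that, rule_format, of m] show ?thesis
        by (auto simp: activation_gap_after)
    qed (use st in simp)
    then show ?thesis using * by blast
  qed
  have 2: "\<zeta> (?u + t) \<omega> = attraction_update E \<tau> e' (choice_after e choice e' n \<omega>) (\<zeta> (?u + s) \<omega>)"
    if "e' \<in> S" "activation (gap_after e gap) e' n \<omega> = t" for e' n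
  proof -
    have "activation gap e' (if e' = e then Suc n else n) \<omega> = ?u + t"
      using that(2) by (simp add: activation_gap_after)
    then show ?thesis
      using * that(1) unfolding choice_after_def by blast
  qed
  show "((\<forall>e'\<in>S. \<forall>n. activation (gap_after e gap) e' n \<omega> \<noteq> t) \<longrightarrow>
      \<zeta> (\<bar>?u\<bar> + t) \<omega> = \<zeta> (\<bar>?u\<bar> + s) \<omega>) \<and>
     (\<forall>e'\<in>S. \<forall>n. activation (gap_after e gap) e' n \<omega> = t \<longrightarrow>
       \<zeta> (\<bar>?u\<bar> + t) \<omega> = attraction_update E \<tau> e' (choice_after e choice e' n \<omega>) (\<zeta> (\<bar>?u\<bar> + s) \<omega>))"
    using 1 2 pos by simp
qed

text \<open>A constant configuration is absorbing since equal opinions do not interact. The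
  evolution property only bridges intervals free of activations, hence the induction on the number
  of activation times before \<open>t\<close>.\<close>

lemma evolves_const:
  assumes ev: "evolves S E \<tau> gap choice \<zeta> \<omega>" and init: "\<zeta> 0 \<omega> = (\<lambda>_. c)"
    and fin: "\<And>t. finite ({activation gap e n \<omega> | e n. e \<in> S} \<inter> {0<..<t})"
    and t: "0 \<le> t"
  shows "\<zeta> t \<omega> = (\<lambda>_. c)"
  using t
proof (induction "card ({activation gap e n \<omega> | e n. e \<in> S} \<inter> {0<..<t})" arbitrary: t rule: less_induct)
  case less
  let ?A = "{activation gap e n \<omega> | e n. e \<in> S}"
  have upd: "attraction_update E \<tau> e f (\<lambda>_. c) = (\<lambda>_. c)" for e f
  proof -
    have "gdist E c c \<le> 0" by (rule gdist_le) simp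
    then show ?thesis by (simp add: attraction_update_def split: prod.split)
  qed
  show ?case
  proof (cases "t = 0")
    case False
    \<comment> \<open>The last activation before \<open>t\<close>, with 0 as default when there is
      none.\<close>
    define s where "s = Max (insert 0 (?A \<inter> {0<..<t}))"
    have "s \<in> insert 0 (?A \<inter> {0<..<t})"
      unfolding s_def using fin by (intro Max_in) auto
    then have s: "0 \<le> s" "s < t" using less.prems False by auto
    have le: "a \<le> s" if "a \<in> ?A \<inter> {0<..<t}" for a
      unfolding s_def using that fin by (intro Max_ge) auto
    have none: "\<forall>e\<in>S. \<forall>n. activation gap e n \<omega> \<notin> {s<..<t}"
    proof (intro ballI allI notI)
      fix e n assume "e \<in> S" "activation gap e n \<omega> \<in> {s<..<t}"
      then have "activation gap e n \<omega> \<le> s"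
        using s by (intro le IntI CollectI exI conjI) auto
      with \<open>activation gap e n \<omega> \<in> {s<..<t}\<close> show False by simp
    qed
    have "\<zeta> s \<omega> = (\<lambda>_. c)"
    proof (cases "s = 0")
      case False
      then have "s \<in> ?A \<inter> {0<..<t}" using \<open>s \<in> insert 0 (?A \<inter> {0<..<t})\<close> by simp
      moreover have "?A \<inter> {0<..<s} \<subseteq> ?A \<inter> {0<..<t}" "s \<notin> ?A \<inter> {0<..<s}" using s by auto
      ultimately have "?A \<inter> {0<..<s} \<subset> ?A \<inter> {0<..<t}" by blast
      then have "card (?A \<inter> {0<..<s}) < card (?A \<inter> {0<..<t})"
        by (rule psubset_card_mono[OF fin])
      then show ?thesis using s by (intro less.hyps)
    qed (use init in simp)
    moreover have "\<zeta> t \<omega> = \<zeta> s \<omega> \<or> (\<exists>e f. \<zeta> t \<omega> = attraction_update E \<tau> e f (\<zeta> s \<omega>))"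
      using ev[unfolded evolves_def, THEN spec, THEN spec, THEN mp, THEN mp, THEN mp, OF s none] by blast
    ultimately show ?thesis using upd by auto
  qed (use init in simp)
qed

section \<open>Independent sources and systems with a deterministic start\<close>

text \<open>\<open>Initial\<close> is left out because systems start from a deterministic
  configuration; \<open>insert\<close> puts it back for the original process.\<close>

definition sources :: "'e set \<Rightarrow> 'e source set" where
  "sources S = {Clock e n | e n. e \<in> S} \<union> {Choice e n | e n. e \<in> S}"

lemma sources_simps [simp]:
  "Clock e n \<in> sources S \<longleftrightarrow> e \<in> S" "Choice e n \<in> sources S \<longleftrightarrow> e \<in> S" "Initial \<notin> sources S"
  unfolding sources_def by blast+

text \<open>
  Choice functions range over a finite type; coding them as reals gives all sources a common
  range, so that a single family of real random variables carries the independence.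
\<close>

definition coded :: "('w \<Rightarrow> real) \<Rightarrow> ('e \<Rightarrow> nat \<Rightarrow> 'w \<Rightarrow> real) \<Rightarrow> ('e \<Rightarrow> nat \<Rightarrow> 'w \<Rightarrow> 'c::countable) \<Rightarrow>
    'e source \<Rightarrow> 'w \<Rightarrow> real" where
  "coded z gap choice i \<omega> = (case i of Initial \<Rightarrow> z \<omega> | Clock e n \<Rightarrow> gap e n \<omega>
     | Choice e n \<Rightarrow> real (to_nat (choice e n \<omega>)))"

lemma coded_simps [simp]:
  "coded z gap choice Initial = z" "coded z gap choice (Clock e n) = gap e n"
  "coded z gap choice (Choice e n) = (\<lambda>\<omega>. real (to_nat (choice e n \<omega>)))"
  by (simp_all add: coded_def fun_eq_iff)

text \<open>The first sum says that the law of a coded choice function is carried by the codes; the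
  second prescribes its marginal at each pair of distinct opinions.\<close>

definition source_law :: "'e set \<Rightarrow> ('a::finite \<times> 'a) set \<Rightarrow> ('e source \<Rightarrow> real measure) \<Rightarrow> bool" where
  "source_law S E D \<longleftrightarrow> (\<forall>e n. D (Clock e n) = std_exponential) \<and>
     (\<forall>e\<in>S. \<forall>n. (\<Sum>c\<in>UNIV. measure (D (Choice e n)) {real (to_nat (c :: 'a \<Rightarrow> 'a \<Rightarrow> 'a))}) = 1 \<and>
       (\<forall>a b a'. a \<noteq> b \<longrightarrow> (\<Sum>c | c a b = a'. measure (D (Choice e n)) {real (to_nat (c :: 'a \<Rightarrow> 'a \<Rightarrow> 'a))}) =
          pmf (pmf_of_set (toward E a b)) a'))"

text \<open>
  The attraction process started from the deterministic configuration \<open>\<eta>\<close>, retaining only what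
  survives conditioning on the first activation. The event \<open>K\<close> stands for eventual consensus; it
  is kept fixed along the conditionings, so that its measurability is inherited.
\<close>

definition attraction_system ::
  "'w measure \<Rightarrow> ('v::finite \<times> 'v) set \<Rightarrow> ('a::finite \<times> 'a) set \<Rightarrow> nat \<Rightarrow>
   ('v \<times> 'v \<Rightarrow> nat \<Rightarrow> 'w \<Rightarrow> real) \<Rightarrow> ('v \<times> 'v \<Rightarrow> nat \<Rightarrow> 'w \<Rightarrow> 'a \<Rightarrow> 'a \<Rightarrow> 'a) \<Rightarrow>
   (real \<Rightarrow> 'w \<Rightarrow> 'v \<Rightarrow> 'a) \<Rightarrow> ('v \<Rightarrow> 'a) \<Rightarrow> 'w set \<Rightarrow> bool" where
  "attraction_system M S E \<tau> gap choice \<zeta> \<eta> K \<longleftrightarrow>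
     (\<exists>D. product_law M (coded (\<lambda>_. 0) gap choice) D (sources S) \<and> source_law S E D) \<and>
     K \<in> sets M \<and>
     (\<forall>\<omega>\<in>space M. (\<exists>t\<ge>0. \<exists>c. \<forall>s\<ge>t. \<zeta> s \<omega> = (\<lambda>_. c)) \<longrightarrow> \<omega> \<in> K) \<and>
     (AE \<omega> in M. \<zeta> 0 \<omega> = \<eta>) \<and>
     (AE \<omega> in M. evolves S E \<tau> gap choice \<zeta> \<omega>)"

section \<open>Almost sure behaviour of the clocks\<close>

lemma measure_std_exponential_greaterThan:
  assumes "0 \<le> u"
  shows "measure std_exponential {u<..} = exp (- u)"
proof -
  interpret prob_space std_exponential by (rule prob_space_std_exponential)
  have "{u<..} = {v. u < v \<and> v - u \<in> UNIV}" by auto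
  then have "emeasure std_exponential {u<..} = ennreal (exp (- u)) * emeasure std_exponential UNIV"
    using emeasure_std_exponential_shift[of UNIV u] assms by simp
  also have "emeasure std_exponential UNIV = 1" using emeasure_space_1 by simp
  finally show ?thesis by (simp add: measure_def)
qed

lemma AE_gap_pos:
  fixes S :: "'e::finite set"
  assumes P: "product_law M (coded z gap choice) D I" and D: "source_law S E D"
    and I: "sources S \<subseteq> I"
  shows "AE \<omega> in M. \<forall>e\<in>S. \<forall>n. 0 < gap e n \<omega>"
proof -
  interpret prob_space M by (rule product_lawD(1)[OF P])
  have "AE \<omega> in M. 0 < gap e n \<omega>" if "e \<in> S" for e n
  proof -
    have i: "Clock e n \<in> I" using that I by (auto simp: sources_def)
    have [measurable]: "gap e n \<in> borel_measurable M"
      using product_lawD(4)[OF P i] by simp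
    have "measure M {\<omega> \<in> space M. gap e n \<omega> \<in> {0<..}} = 1"
      using product_law_single[OF P i, of "{0<..}"] D measure_std_exponential_greaterThan[of 0]
      by (simp add: source_law_def)
    then show ?thesis by (subst (asm) prob_Collect_eq_1) auto
  qed
  then have "AE \<omega> in M. \<forall>n. 0 < gap e n \<omega>" if "e \<in> S" for e
    using that by (simp add: AE_all_countable)
  then show ?thesis by (intro AE_finite_allI) auto
qed

text \<open>The probability that \<open>k\<close> consecutive gaps are all at most 1 is
  \<open>?q ^ k\<close>, which tends to 0. Infinitely many gaps above 1 exclude an accumulation of
  activations.\<close>

lemma AE_gap_gt_1_infinitely_often:
  fixes S :: "'e::finite set"
  assumes P: "product_law M (coded z gap choice) D I" and D: "source_law S E D"
    and I: "sources S \<subseteq> I"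
  shows "AE \<omega> in M. \<forall>e\<in>S. \<forall>m. \<exists>n\<ge>m. 1 < gap e n \<omega>"
proof -
  interpret prob_space M by (rule product_lawD(1)[OF P])
  let ?q = "measure std_exponential {..1}"
  have q: "0 \<le> ?q" "?q < 1"
  proof -
    interpret E: prob_space std_exponential by (rule prob_space_std_exponential)
    have "?q = 1 - measure std_exponential {1<..}"
      using E.prob_compl[of "{1<..}"] by (simp add: Compl_greaterThan flip: Compl_eq_Diff_UNIV)
    then show "?q < 1" using measure_std_exponential_greaterThan[of 1] by simp
  qed simp
  have "AE \<omega> in M. \<exists>n\<ge>m. 1 < gap e n \<omega>" if e: "e \<in> S" for e m
  proof -
    have i: "Clock e n \<in> I" for n using e I by (auto simp: sources_def)
    have [measurable]: "gap e n \<in> borel_measurable M" for n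
      using product_lawD(4)[OF P i[of n]] by simp
    let ?B = "{\<omega> \<in> space M. \<forall>n\<ge>m. gap e n \<omega> \<le> 1}"
    have "measure M ?B \<le> ?q ^ k" for k
    proof -
      let ?J = "Clock e ` {m..<m + k}"
      have inj: "inj_on (Clock e) {m..<m + k}" by (auto simp: inj_on_def)
      have "measure M ?B \<le> measure M {\<omega> \<in> space M. \<forall>i\<in>?J. coded z gap choice i \<omega> \<in> {..1}}"
        by (intro finite_measure_mono) auto
      also have "\<dots> = (\<Prod>i\<in>?J. measure (D i) {..1})"
        using i by (intro product_lawD(5)[OF P]) auto
      also have "\<dots> = ?q ^ k"
        using D by (simp add: prod.reindex[OF inj] source_law_def)
      finally show ?thesis .
    qed
    moreover have "(\<lambda>k. ?q ^ k) \<longlonglongrightarrow> 0" using q by (intro LIMSEQ_power_zero) simp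
    ultimately have "measure M ?B \<le> 0" by (intro LIMSEQ_le_const) auto
    then have "measure M ?B = 0" by (simp add: measure_le_0_iff)
    then have "AE \<omega> in M. \<not> (\<forall>n\<ge>m. gap e n \<omega> \<le> 1)"
      by (subst (asm) prob_Collect_eq_0) auto
    then show ?thesis by eventually_elim (auto simp: not_le)
  qed
  then have "AE \<omega> in M. \<forall>m. \<exists>n\<ge>m. 1 < gap e n \<omega>" if "e \<in> S" for e
    using that by (simp add: AE_all_countable)
  then show ?thesis by (intro AE_finite_allI) auto
qed

lemma activation_unbounded:
  assumes pos: "\<And>n. 0 < gap e n \<omega>" and inf: "\<And>m. \<exists>n\<ge>m. 1 < gap e n \<omega>"
  shows "\<exists>n. real k \<le> activation gap e n \<omega>"
proof (induction k)
  case 0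
  show ?case using pos[of 0] by (intro exI[of _ 0]) simp
next
  case (Suc k)
  then obtain n where n: "real k \<le> activation gap e n \<omega>" by blast
  obtain m where m: "Suc n \<le> m" "1 < gap e m \<omega>" using inf by blast
  then obtain l where l: "m = Suc l" "n \<le> l" by (cases m) auto
  have "activation gap e n \<omega> \<le> activation gap e l \<omega>"
    using pos l(2) by (rule activation_mono)
  then show ?case using n m l by (intro exI[of _ m]) simp
qed

lemma finite_activations:
  fixes S :: "('v::finite \<times> 'v) set"
  assumes pos: "\<And>e n. e \<in> S \<Longrightarrow> 0 < gap e n \<omega>"
    and inf: "\<And>e m. e \<in> S \<Longrightarrow> \<exists>n\<ge>m. 1 < gap e n \<omega>"
  shows "finite ({activation gap e n \<omega> | e n. e \<in> S} \<inter> {0<..<t})"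
proof -
  have "finite ((\<lambda>n. activation gap e n \<omega>) ` {n. activation gap e n \<omega> < t})" if e: "e \<in> S" for e
  proof -
    obtain n where "real (nat \<lceil>t\<rceil>) \<le> activation gap e n \<omega>"
      using activation_unbounded[of gap e \<omega> "nat \<lceil>t\<rceil>"] pos inf e by blast
    then have n: "t \<le> activation gap e n \<omega>" by linarith
    have "{n. activation gap e n \<omega> < t} \<subseteq> {..<n}"
      using activation_mono[of gap e \<omega> n] pos[OF e] n by (force simp: not_le[symmetric])
    then show ?thesis by (meson finite_imageI finite_lessThan finite_subset)
  qed
  then have "finite (\<Union>e\<in>S. (\<lambda>n. activation gap e n \<omega>) ` {n. activation gap e n \<omega> < t})"
    by (intro finite_UN_I) auto
  then show ?thesis by (rule rev_finite_subset) auto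
qed

text \<open>The boundary value for the maximum principle: almost surely only finitely many
  activations precede any given time, and none of them changes a constant configuration.\<close>

lemma system_const:
  assumes "attraction_system M S E \<tau> gap choice \<zeta> (\<lambda>_. c) K"
  shows "measure M K = 1"
proof -
  obtain D where P: "product_law M (coded (\<lambda>_. 0) gap choice) D (sources S)" and D: "source_law S E D"
    and K: "K \<in> sets M" "\<And>\<omega>. \<omega> \<in> space M \<Longrightarrow> \<exists>t\<ge>0. \<exists>c. \<forall>s\<ge>t. \<zeta> s \<omega> = (\<lambda>_. c) \<Longrightarrow> \<omega> \<in> K"
    and init: "AE \<omega> in M. \<zeta> 0 \<omega> = (\<lambda>_. c)" and ev: "AE \<omega> in M. evolves S E \<tau> gap choice \<zeta> \<omega>"
    using assms unfolding attraction_system_def by blast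
  interpret prob_space M by (rule product_lawD(1)[OF P])
  have "AE \<omega> in M. \<omega> \<in> K"
    using init ev AE_gap_pos[OF P D order_refl] AE_gap_gt_1_infinitely_often[OF P D order_refl] AE_space
  proof eventually_elim
    case (elim \<omega>)
    have pos: "0 < gap e n \<omega>" if "e \<in> S" for e n using elim(3) that by simp
    have inf: "\<exists>n\<ge>m. 1 < gap e n \<omega>" if "e \<in> S" for e m using elim(4) that by simp
    have "\<zeta> t \<omega> = (\<lambda>_. c)" if "0 \<le> t" for t
      by (rule evolves_const[OF elim(2,1) finite_activations that]) (fact pos inf)+
    then have "\<exists>t\<ge>0. \<exists>c. \<forall>s\<ge>t. \<zeta> s \<omega> = (\<lambda>_. c)" by (intro exI[of _ 0] conjI exI[of _ c]) simp_all
    then show ?case by (rule K(2)[OF elim(5)])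
  qed
  then show ?thesis using K(1) by (simp add: prob_eq_1)
qed

section \<open>Conditioning on the first activation\<close>

text \<open>The index of the source that plays the part of \<open>i\<close> after the first ring of
  \<open>e\<close>: only the counters of \<open>e\<close> advance, as its clock 0 and choice 0 are
  spent.\<close>

definition later :: "'e \<Rightarrow> 'e source \<Rightarrow> 'e source" where
  "later e i = (case i of Initial \<Rightarrow> Initial
     | Clock e' n \<Rightarrow> Clock e' (if e' = e then Suc n else n)
     | Choice e' n \<Rightarrow> Choice e' (if e' = e then Suc n else n))"

text \<open>The strict comparison makes these events disjoint for different edges.\<close>

definition first_ring :: "'w measure \<Rightarrow> 'e set \<Rightarrow> ('e \<Rightarrow> nat \<Rightarrow> 'w \<Rightarrow> real) \<Rightarrow> 'e \<Rightarrow> 'w set" where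
  "first_ring M S gap e = {\<omega> \<in> space M. \<forall>e'\<in>S. e' \<noteq> e \<longrightarrow> gap e 0 \<omega> < gap e' 0 \<omega>}"

lemma inj_later: "inj (later e)"
proof (rule injI)
  fix i j assume "later e i = later e j"
  then show "i = j"
    by (cases i; cases j) (auto simp: later_def split: if_splits)
qed

lemma later_sources: "later e ` sources S \<subseteq> sources S - {Clock e 0} - {Choice e 0}"
  by (auto simp: sources_def later_def)

lemma source_law_later: "source_law S E D \<Longrightarrow> source_law S E (\<lambda>i. D (later e i))"
  by (simp add: source_law_def later_def)

text \<open>The race whose competitors are the clocks numbered 0 of all edges; equal rates give
  every edge the same chance to be first.\<close>

lemma product_law_first_ring:
  fixes S :: "'e::finite set" and choice :: "'e \<Rightarrow> nat \<Rightarrow> 'w \<Rightarrow> 'c::countable"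
  assumes P: "product_law M (coded z gap choice) D (sources S)" and D: "source_law S E D" and e: "e \<in> S"
  shows "first_ring M S gap e \<in> sets M" "measure M (first_ring M S gap e) = 1 / card S"
    "product_law (uniform_measure M (first_ring M S gap e))
       (\<lambda>i \<omega>. if i \<in> (\<lambda>e. Clock e 0) ` S - {Clock e 0}
          then coded z gap choice i \<omega> - coded z gap choice (Clock e 0) \<omega> else coded z gap choice i \<omega>)
       D (sources S - {Clock e 0})"
proof -
  let ?F = "(\<lambda>e. Clock e 0) ` S"
  have F: "finite ?F" "?F \<subseteq> sources S" "Clock e 0 \<in> ?F"
    using e by auto
  have D': "D i = std_exponential" if "i \<in> ?F" for i
    using D that by (auto simp: source_law_def)
  have "inj_on (\<lambda>e. Clock e (0::nat)) S" by (auto simp: inj_on_def)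
  then have card: "card ?F = card S" by (rule card_image)
  have H: "first_ring M S gap e =
      {\<omega> \<in> space M. \<forall>i\<in>?F - {Clock e 0}. coded z gap choice (Clock e 0) \<omega> < coded z gap choice i \<omega>}"
  proof -
    have "(\<forall>i\<in>?F - {Clock e 0}. Q i) \<longleftrightarrow> (\<forall>e'\<in>S. e' \<noteq> e \<longrightarrow> Q (Clock e' 0))" for Q by auto
    then show ?thesis by (simp add: first_ring_def)
  qed
  show "first_ring M S gap e \<in> sets M" "measure M (first_ring M S gap e) = 1 / card S"
    "product_law (uniform_measure M (first_ring M S gap e))
       (\<lambda>i \<omega>. if i \<in> ?F - {Clock e 0}
          then coded z gap choice i \<omega> - coded z gap choice (Clock e 0) \<omega> else coded z gap choice i \<omega>)
       D (sources S - {Clock e 0})"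
    using product_law_race[OF P F D'] unfolding H card by blast+
qed

text \<open>
  The absolute value keeps the shifted time nonnegative also on the null event of a negative gap.
\<close>

lemma
  fixes S :: "('v::finite \<times> 'v) set" and E :: "('a::finite \<times> 'a) set"
    and M :: "'w measure" and c :: "'a \<Rightarrow> 'a \<Rightarrow> 'a"
  assumes P: "product_law M (coded (\<lambda>_. 0) gap choice) D (sources S)" and D: "source_law S E D"
    and sys: "attraction_system M S E \<tau> gap choice \<zeta> \<eta> K" and e: "e \<in> S"
  defines "N \<equiv> uniform_measure M (first_ring M S gap e)"
    and "C \<equiv> {\<omega> \<in> space M. choice e 0 \<omega> = c}"
  shows first_choice_sets: "C \<in> sets M"
    and first_choice_measure: "measure N C = measure (D (Choice e 0)) {real (to_nat c)}"
    and attraction_system_step: "measure N C > 0 \<Longrightarrow>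
      attraction_system (uniform_measure N C) S E \<tau> (gap_after e gap) (choice_after e choice)
        (\<lambda>t \<omega>. \<zeta> (\<bar>gap e 0 \<omega>\<bar> + t) \<omega>) (attraction_update E \<tau> e c \<eta>) K"
proof -
  let ?F = "(\<lambda>e. Clock e 0) ` S" and ?X = "coded (\<lambda>_. 0) gap choice" and ?H = "first_ring M S gap e"
  let ?Y = "\<lambda>i \<omega>. if i \<in> ?F - {Clock e 0} then ?X i \<omega> - ?X (Clock e 0) \<omega> else ?X i \<omega>"
  have K: "K \<in> sets M" "\<And>\<omega>. \<omega> \<in> space M \<Longrightarrow> \<exists>t\<ge>0. \<exists>c. \<forall>s\<ge>t. \<zeta> s \<omega> = (\<lambda>_. c) \<Longrightarrow> \<omega> \<in> K"
    and init: "AE \<omega> in M. \<zeta> 0 \<omega> = \<eta>" and ev: "AE \<omega> in M. evolves S E \<tau> gap choice \<zeta> \<omega>"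
    using sys unfolding attraction_system_def by blast+
  interpret prob_space M by (rule product_lawD(1)[OF P])
  note H = product_law_first_ring[OF P D e, folded N_def]
  interpret N: prob_space N by (rule product_lawD(1)[OF H(3)])
  have spN [simp]: "space N = space M" and seN [simp]: "sets N = sets M" by (simp_all add: N_def)
  have i: "Choice e 0 \<in> sources S" "Choice e 0 \<in> sources S - {Clock e 0}"
    using e by simp_all
  have Y: "?Y (Choice e 0) \<omega> = real (to_nat (choice e 0 \<omega>))" for \<omega>
    by (auto simp:)
  have C: "C = {\<omega> \<in> space N. ?Y (Choice e 0) \<omega> \<in> {real (to_nat c)}}"
    unfolding Y C_def by auto
  have m: "?Y (Choice e 0) \<in> borel_measurable N" by (rule product_lawD(4)[OF H(3) i(2)])
  have "?Y (Choice e 0) -` {real (to_nat c)} \<inter> space N \<in> sets N"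
    using m by (rule measurable_sets) simp
  also have "?Y (Choice e 0) -` {real (to_nat c)} \<inter> space N = C" unfolding C by auto
  finally show Cs: "C \<in> sets M" by simp
  show "measure N C = measure (D (Choice e 0)) {real (to_nat c)}"
    unfolding C by (rule product_law_single[OF H(3) i(2)]) simp
  assume pos: "measure N C > 0"
  let ?N = "uniform_measure N C"
  \<comment> \<open>The choice made at the ring is conditioned on and leaves the family, as the
    winning clock did before. What remains contains the image of \<open>sources S\<close> under
    \<open>later e\<close>.\<close>
  have "product_law ?N ?Y D (sources S - {Clock e 0} - {Choice e 0})"
    using product_law_condition[OF H(3) i(2), of "{real (to_nat c)}"] pos unfolding C by simp
  then have "product_law ?N (\<lambda>i. ?Y (later e i)) (\<lambda>i. D (later e i)) (sources S)"
    by (rule product_law_reindex[OF _ inj_on_subset[OF inj_later subset_UNIV] later_sources])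
  then have P': "product_law ?N (coded (\<lambda>_. 0) (gap_after e gap) (choice_after e choice))
      (\<lambda>i. D (later e i)) (sources S)"
  proof (rule product_law_cong)
    fix i \<omega> assume "i \<in> sources S"
    then show "?Y (later e i) \<omega> = coded (\<lambda>_. 0) (gap_after e gap) (choice_after e choice) i \<omega>"
      by (cases i) (auto simp: later_def gap_after_def choice_after_def)
  qed
  have all: "AE \<omega> in M. \<zeta> 0 \<omega> = \<eta> \<and> evolves S E \<tau> gap choice \<zeta> \<omega> \<and> (\<forall>e\<in>S. \<forall>n. 0 < gap e n \<omega>)"
    using init ev AE_gap_pos[OF P D order_refl] by eventually_elim blast
  \<comment> \<open>\<open>?N\<close> arises from two nested conditionings, so almost sure
    statements are transferred twice.\<close>
  have AE_N: "AE \<omega> in ?N. Q \<omega>" if "AE \<omega> in M. \<omega> \<in> ?H \<longrightarrow> \<omega> \<in> C \<longrightarrow> Q \<omega>" for Q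
  proof (rule AE_uniform_measureI)
    show "C \<in> sets N" using Cs by simp
    show "AE \<omega> in N. \<omega> \<in> C \<longrightarrow> Q \<omega>"
      unfolding N_def by (rule AE_uniform_measureI[OF H(1) that])
  qed
  have init': "AE \<omega> in ?N. \<zeta> (\<bar>gap e 0 \<omega>\<bar> + 0) \<omega> = attraction_update E \<tau> e c \<eta>"
  proof (rule AE_N)
    show "AE \<omega> in M. \<omega> \<in> ?H \<longrightarrow> \<omega> \<in> C \<longrightarrow> \<zeta> (\<bar>gap e 0 \<omega>\<bar> + 0) \<omega> = attraction_update E \<tau> e c \<eta>"
      using all
    proof eventually_elim
      case (elim \<omega>)
      then have p: "0 < gap e' n \<omega>" if "e' \<in> S" for e' n using that by blast
      show ?case
      proof (intro impI)
        assume \<omega>: "\<omega> \<in> ?H" "\<omega> \<in> C"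
        have "\<zeta> (gap e 0 \<omega>) \<omega> = attraction_update E \<tau> e (choice e 0 \<omega>) (\<zeta> 0 \<omega>)"
          using elim \<omega>(1) p by (intro evolves_first[OF _ e]) (auto simp: first_ring_def)
        then show "\<zeta> (\<bar>gap e 0 \<omega>\<bar> + 0) \<omega> = attraction_update E \<tau> e c \<eta>"
          using \<omega>(2) p[OF e, of 0] elim by (simp add: C_def)
      qed
    qed
  qed
  have ev': "AE \<omega> in ?N. evolves S E \<tau> (gap_after e gap) (choice_after e choice)
      (\<lambda>t \<omega>. \<zeta> (\<bar>gap e 0 \<omega>\<bar> + t) \<omega>) \<omega>"
  proof (rule AE_N)
    show "AE \<omega> in M. \<omega> \<in> ?H \<longrightarrow> \<omega> \<in> C \<longrightarrow> evolves S E \<tau> (gap_after e gap) (choice_after e choice)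
      (\<lambda>t \<omega>. \<zeta> (\<bar>gap e 0 \<omega>\<bar> + t) \<omega>) \<omega>"
      using all
    proof eventually_elim
      case (elim \<omega>)
      then have "evolves S E \<tau> gap choice \<zeta> \<omega>" "0 < gap e 0 \<omega>" using e by blast+
      then show ?case by (intro impI evolves_after[OF _ e])
    qed
  qed
  \<comment> \<open>Eventual consensus is insensitive to a shift of time, so the same event
    \<open>K\<close> serves the new system.\<close>
  have K': "\<omega> \<in> K" if \<omega>: "\<omega> \<in> space M"
    and ex: "\<exists>t\<ge>0. \<exists>c. \<forall>s\<ge>t. \<zeta> (\<bar>gap e 0 \<omega>\<bar> + s) \<omega> = (\<lambda>_. c)" for \<omega>
  proof -
    obtain t c where t: "0 \<le> t" "\<And>s. t \<le> s \<Longrightarrow> \<zeta> (\<bar>gap e 0 \<omega>\<bar> + s) \<omega> = (\<lambda>_. c)"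
      using ex by blast
    have "\<zeta> s \<omega> = (\<lambda>_. c)" if "\<bar>gap e 0 \<omega>\<bar> + t \<le> s" for s
      using t(2)[of "s - \<bar>gap e 0 \<omega>\<bar>"] that by simp
    then have "\<exists>t\<ge>0. \<exists>c. \<forall>s\<ge>t. \<zeta> s \<omega> = (\<lambda>_. c)"
      using t(1) by (intro exI[of _ "\<bar>gap e 0 \<omega>\<bar> + t"] conjI exI[of _ c]) simp_all
    then show ?thesis by (rule K(2)[OF \<omega>])
  qed
  show "attraction_system ?N S E \<tau> (gap_after e gap) (choice_after e choice)
      (\<lambda>t \<omega>. \<zeta> (\<bar>gap e 0 \<omega>\<bar> + t) \<omega>) (attraction_update E \<tau> e c \<eta>) K"
    unfolding attraction_system_def
  proof (intro conjI ballI impI)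
    show "\<exists>D. product_law ?N (coded (\<lambda>_. 0) (gap_after e gap) (choice_after e choice)) D (sources S) \<and>
        source_law S E D"
      using P' source_law_later[OF D] by blast
    show "K \<in> sets ?N" using K(1) by simp
    show "\<omega> \<in> K" if "\<omega> \<in> space ?N" "\<exists>t\<ge>0. \<exists>c. \<forall>s\<ge>t. \<zeta> (\<bar>gap e 0 \<omega>\<bar> + s) \<omega> = (\<lambda>_. c)" for \<omega>
      using K' that by simp
  qed (fact init' ev')+
qed

lemma sum_partition_measure_le:
  assumes "prob_space M" "finite I" "K \<in> sets M" "\<And>i. i \<in> I \<Longrightarrow> A i \<in> sets M" "disjoint_family_on A I"
  shows "(\<Sum>i\<in>I. measure M (A i \<inter> K)) \<le> measure M K"
proof -
  interpret prob_space M by fact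
  have "(\<Sum>i\<in>I. measure M (A i \<inter> K)) = measure M (\<Union>i\<in>I. A i \<inter> K)"
    using assms by (intro finite_measure_finite_Union[symmetric]) (auto simp: disjoint_family_on_def)
  also have "\<dots> \<le> measure M K"
    using assms by (intro finite_measure_mono) auto
  finally show ?thesis .
qed

text \<open>The update depends on the choice function only through its value at the two current
  opinions. Grouping by that value leaves its uniform marginal; on a blocked edge the total mass 1
  remains.\<close>

lemma sum_choice_law:
  fixes E :: "('a::finite \<times> 'a) set"
  assumes D: "source_law S E D" and e: "e \<in> S" and conn: "connected_graph E"
  shows "(\<Sum>c\<in>UNIV. measure (D (Choice e n)) {real (to_nat c)} * h (attraction_update E \<tau> e c \<eta>)) =
    local_mean E \<tau> h \<eta> e"
proof -
  obtain x y where xy: "e = (x, y)" by (cases e)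
  let ?p = "\<lambda>c :: 'a \<Rightarrow> 'a \<Rightarrow> 'a. measure (D (Choice e n)) {real (to_nat c)}"
  let ?a = "\<eta> x" and ?b = "\<eta> y"
  show ?thesis
  proof (cases "0 < gdist E ?a ?b \<and> gdist E ?a ?b \<le> \<tau>")
    case True
    then have ab: "?a \<noteq> ?b" using gdist_eq_0_iff[OF conn, of ?a ?b] by auto
    let ?T = "toward E ?a ?b"
    have T: "?T \<noteq> {}" "finite ?T" using toward_nonempty[OF conn ab] by auto
    have "(\<Sum>c\<in>UNIV. ?p c * h (attraction_update E \<tau> e c \<eta>)) = (\<Sum>c\<in>UNIV. ?p c * h (\<eta>(x := c ?a ?b)))"
      using True by (simp add: attraction_update_def xy)
    also have "\<dots> = (\<Sum>a'\<in>UNIV. \<Sum>c | c ?a ?b = a'. ?p c * h (\<eta>(x := c ?a ?b)))"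
      by (subst sum.group[symmetric, where T=UNIV and g="\<lambda>c. c ?a ?b"]) simp_all
    also have "\<dots> = (\<Sum>a'\<in>UNIV. (\<Sum>c | c ?a ?b = a'. ?p c) * h (\<eta>(x := a')))"
      unfolding sum_distrib_right by (intro sum.cong) auto
    also have "\<dots> = (\<Sum>a'\<in>UNIV. pmf (pmf_of_set ?T) a' * h (\<eta>(x := a')))"
      using D e ab by (simp add: source_law_def)
    also have "\<dots> = (\<Sum>a'\<in>UNIV. indicator ?T a' * h (\<eta>(x := a')) / card ?T)"
      using T by simp
    also have "\<dots> = (\<Sum>a'\<in>?T. h (\<eta>(x := a')) / card ?T)"
      by (intro sum.mono_neutral_cong_right) auto
    also have "\<dots> = local_mean E \<tau> h \<eta> e"
      using True by (simp add: local_mean_def xy sum_divide_distrib)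
    finally show ?thesis .
  next
    case False
    then have "attraction_update E \<tau> e c \<eta> = \<eta>" for c
      by (auto simp add: attraction_update_def xy)
    then have "(\<Sum>c\<in>UNIV. ?p c * h (attraction_update E \<tau> e c \<eta>)) = (\<Sum>c\<in>UNIV. ?p c) * h \<eta>"
      by (simp add: sum_distrib_right)
    also have "\<dots> = h \<eta>" using D e by (simp add: source_law_def)
    finally show ?thesis using False by (auto simp: local_mean_def xy)
  qed
qed

text \<open>\<open>K\<close> is split according to the first edge to ring and the choice function
  used there. The pieces are disjoint, and conditioning on one of positive probability yields a
  system with the same \<open>K\<close>, to which \<open>lower\<close> applies.\<close>

lemma system_superharmonic:
  fixes S :: "('v::finite \<times> 'v) set" and E :: "('a::finite \<times> 'a) set" and M :: "'w measure"
  assumes conn: "connected_graph E" and sys: "attraction_system M S E \<tau> gap choice \<zeta> \<eta> K"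
    and lower: "\<And>(N :: 'w measure) gap choice \<zeta> \<eta>.
      attraction_system N S E \<tau> gap choice \<zeta> \<eta> K \<Longrightarrow> h \<eta> \<le> measure N K"
  shows "jump_mean S E \<tau> h \<eta> \<le> measure M K"
proof -
  obtain D where P: "product_law M (coded (\<lambda>_. 0) gap choice) D (sources S)" and D: "source_law S E D"
    and K: "K \<in> sets M"
    using sys unfolding attraction_system_def by blast
  interpret prob_space M by (rule product_lawD(1)[OF P])
  let ?H = "first_ring M S gap"
  have ring: "local_mean E \<tau> h \<eta> e / card S \<le> measure M (?H e \<inter> K)" if e: "e \<in> S" for e
  proof -
    let ?N = "uniform_measure M (?H e)" and ?C = "\<lambda>c. {\<omega> \<in> space M. choice e 0 \<omega> = c}"
    let ?p = "\<lambda>c. measure (D (Choice e 0)) {real (to_nat c)}"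
    note H = product_law_first_ring[OF P D e]
    interpret N: prob_space ?N by (rule product_lawD(1)[OF H(3)])
    have card: "card S > 0" using e by (auto simp: card_gt_0_iff)
    have Hpos: "emeasure M (?H e) \<noteq> 0" "emeasure M (?H e) \<noteq> \<infinity>"
      using H(2) card by (auto simp: emeasure_eq_measure)
    have "?p c * h (attraction_update E \<tau> e c \<eta>) \<le> measure ?N (?C c \<inter> K)" for c
    proof (cases "measure ?N (?C c) > 0")
      case True
      note C = first_choice_sets[OF P D sys e, of c] first_choice_measure[OF P D sys e, of c]
      have e0: "emeasure ?N (?C c) \<noteq> 0" "emeasure ?N (?C c) \<noteq> \<infinity>"
        using True by (auto simp: N.emeasure_eq_measure)
      have "h (attraction_update E \<tau> e c \<eta>) \<le> measure (uniform_measure ?N (?C c)) K"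
        by (rule lower[OF attraction_system_step[OF P D sys e True]])
      also have "\<dots> = measure ?N (?C c \<inter> K) / measure ?N (?C c)"
        using K by (intro measure_uniform_measure[OF e0]) simp
      finally show ?thesis
        using True C(2) by (simp add: field_simps)
    next
      \<comment> \<open>A choice function of probability 0 cannot be conditioned on, but its weight
        vanishes.\<close>
      case False
      then have "?p c = 0"
        using first_choice_measure[OF P D sys e, of c] by (simp add: zero_less_measure_iff)
      then show ?thesis by simp
    qed
    then have "(\<Sum>c\<in>UNIV. ?p c * h (attraction_update E \<tau> e c \<eta>)) \<le> (\<Sum>c\<in>UNIV. measure ?N (?C c \<inter> K))"
      by (intro sum_mono)
    also have "\<dots> \<le> measure ?N K"
      using K first_choice_sets[OF P D sys e]
      by (intro sum_partition_measure_le N.prob_space_axioms) (auto simp: disjoint_family_on_def)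
    also have "\<dots> = measure M (?H e \<inter> K) * card S"
      using H(2) card by (subst measure_uniform_measure[OF Hpos K]) simp
    finally show ?thesis
      unfolding sum_choice_law[OF D e conn] using card by (simp add: field_simps)
  qed
  have "jump_mean S E \<tau> h \<eta> = (\<Sum>e\<in>S. local_mean E \<tau> h \<eta> e / card S)"
    by (simp add: jump_mean_def sum_divide_distrib)
  also have "\<dots> \<le> (\<Sum>e\<in>S. measure M (?H e \<inter> K))"
    by (intro sum_mono ring)
  also have "\<dots> \<le> measure M K"
  proof (intro sum_partition_measure_le prob_space_axioms K)
    show "disjoint_family_on ?H S"
      unfolding disjoint_family_on_def
    proof (intro ballI impI)
      fix e e' assume "e \<in> S" "e' \<in> S" "e \<noteq> e'"
      then have False if "\<omega> \<in> ?H e" "\<omega> \<in> ?H e'" for \<omega>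
        using that by (auto simp: first_ring_def dest: less_asym)
      then show "?H e \<inter> ?H e' = {}" by blast
    qed
  qed (auto intro: product_law_first_ring(1)[OF P D])
  finally show ?thesis .
qed

text \<open>The infimum \<open>h\<close> ranges over the systems on the type \<open>'w\<close> with
  this very event \<open>K\<close>. Conditioning stays in this class, because
  \<open>uniform_measure\<close> changes only the probabilities.\<close>

lemma system_lower_bound:
  fixes S :: "('v::finite \<times> 'v) set" and E :: "('a::finite \<times> 'a) set" and M :: "'w measure"
  assumes S: "connected_graph S" and E: "connected_graph E"
    and r: "graph_radius E \<le> \<tau>" and ineq: "eccentricity_inequalities E"
    and sys: "attraction_system M S E \<tau> gap choice \<zeta> \<eta> K"
  shows "consensus_bound E \<tau> \<eta> \<le> measure M K"
proof -
  define V where "V \<xi> = {measure (N :: 'w measure) K | N gap choice \<zeta>.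
    attraction_system N S E \<tau> gap choice \<zeta> \<xi> K}" for \<xi>
  \<comment> \<open>The element \<open>1\<close> only matters if no system starts from \<open>\<xi>\<close>.\<close>
  define h where "h \<xi> = Inf (insert 1 (V \<xi>))" for \<xi>
  have V: "0 \<le> v" if "v \<in> V \<xi>" for v \<xi>
    using that by (auto simp: V_def)
  have bdd: "bdd_below (insert 1 (V \<xi>))" for \<xi>
    using V[of _ \<xi>] by (intro bdd_belowI[of _ 0]) auto
  have lower: "h \<xi> \<le> measure N K" if "attraction_system N S E \<tau> gap choice \<zeta> \<xi> K"
    for N :: "'w measure" and gap choice \<zeta> \<xi>
    unfolding h_def using that by (intro cInf_lower bdd) (auto simp: V_def)
  have h_le: "h \<xi> \<le> 1" for \<xi>
    unfolding h_def by (intro cInf_lower bdd) simp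
  have "consensus_bound E \<tau> \<eta> \<le> h \<eta>"
  proof (rule consensus_bound_le_superharmonic[OF S E r ineq])
    show "0 \<le> h \<xi>" for \<xi>
      unfolding h_def using V[of _ \<xi>] by (intro cInf_greatest) auto
    show "1 \<le> h (\<lambda>_. c)" for c
      unfolding h_def by (intro cInf_greatest) (auto simp: V_def dest: system_const)
    show "jump_mean S E \<tau> h \<xi> \<le> h \<xi>" for \<xi>
      unfolding h_def[of \<xi>]
    proof (rule cInf_greatest)
      fix v assume "v \<in> insert 1 (V \<xi>)"
      then consider "v = 1" | N gap choice \<zeta> where "v = measure (N :: 'w measure) K"
        "attraction_system N S E \<tau> gap choice \<zeta> \<xi> K"
        by (auto simp: V_def)
      then show "jump_mean S E \<tau> h \<xi> \<le> v"
      proof cases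
        case 1
        have "local_mean E \<tau> h \<xi> e \<le> 1" for e
        proof -
          obtain x y where e: "e = (x, y)" by (cases e)
          have "(\<Sum>a\<in>T. h (\<xi>(x := a))) / card T \<le> 1" for T
          proof (cases "card T = 0")
            case False
            have "(\<Sum>a\<in>T. h (\<xi>(x := a))) \<le> card T"
              using sum_bounded_above[of T "\<lambda>a. h (\<xi>(x := a))" 1] h_le by simp
            moreover have "0 < real (card T)" using False by linarith
            ultimately show ?thesis by (simp only: divide_le_eq_1_pos)
          qed simp
          then show ?thesis using h_le by (simp add: local_mean_def e)
        qed
        then have "(\<Sum>e\<in>S. local_mean E \<tau> h \<xi> e) \<le> card S"
          using sum_bounded_above[of S "local_mean E \<tau> h \<xi>" 1] by simp
        then have "jump_mean S E \<tau> h \<xi> \<le> 1"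
          unfolding jump_mean_def by (intro divide_le_eq_1[THEN iffD2]) (cases "S = {}"; simp add: card_gt_0_iff)
        then show ?thesis using 1 by simp
      next
        case 2
        then show ?thesis using system_superharmonic[OF E 2(2), of h] lower by blast
      qed
    qed simp
  qed
  also have "h \<eta> \<le> measure M K" by (rule lower[OF sys])
  finally show ?thesis .
qed

section \<open>The consensus event\<close>

text \<open>By right-continuity the path is constant on an interval to the right of a finite
  fixation time, so the infimum defining that time is attained. Consensus there is then the same as
  being constant in space and time from some time on.\<close>

lemma consensus_event_eq:
  assumes rc: "\<And>\<omega> t. \<omega> \<in> space M \<Longrightarrow> 0 \<le> t \<Longrightarrow> (\<forall>\<^sub>F s in at_right t. \<zeta> s \<omega> = \<zeta> t \<omega>)"
  shows "consensus_event M \<zeta> = {\<omega> \<in> space M. \<exists>t\<ge>0. \<exists>c. \<forall>s\<ge>t. \<zeta> s \<omega> = (\<lambda>_. c)}"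
proof -
  have attained: "\<exists>t0. fixation_time \<zeta> \<omega> = ereal t0 \<and> 0 \<le> t0 \<and> (\<forall>s\<ge>t0. \<zeta> s \<omega> = \<zeta> t0 \<omega>)"
    if \<omega>: "\<omega> \<in> space M" and fin: "fixation_time \<zeta> \<omega> < \<infinity>" for \<omega>
  proof -
    let ?A = "{t. 0 \<le> t \<and> (\<forall>s>t. \<zeta> t \<omega> = \<zeta> s \<omega>)}"
    have "0 \<le> fixation_time \<zeta> \<omega>"
      unfolding fixation_time_def by (rule Inf_greatest) auto
    with fin obtain t0 where t0: "fixation_time \<zeta> \<omega> = ereal t0" "0 \<le> t0"
      by (cases "fixation_time \<zeta> \<omega>") auto
    obtain b where b: "t0 < b" "\<And>s. t0 < s \<Longrightarrow> s < b \<Longrightarrow> \<zeta> s \<omega> = \<zeta> t0 \<omega>"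
      using rc[OF \<omega> t0(2)] by (auto simp: eventually_at_right_field)
    have "Inf (ereal ` ?A) < ereal b"
      using t0(1) b(1) by (simp add: fixation_time_def)
    then obtain t where t: "t \<in> ?A" "t < b"
      by (auto simp: Inf_less_iff)
    have "ereal t0 \<le> ereal t"
      unfolding t0(1)[symmetric] fixation_time_def using t(1) by (intro Inf_lower) auto
    then have "t0 \<le> t" by simp
    \<comment> \<open>The time \<open>s0\<close> lies in both regimes: after \<open>t\<close> the
      path has its final value, before \<open>b\<close> the value at \<open>t0\<close>.\<close>
    obtain s0 where "t < s0" "s0 < b" using dense[OF t(2)] by blast
    then have "\<zeta> t \<omega> = \<zeta> t0 \<omega>"
      using t(1) b(2)[of s0] \<open>t0 \<le> t\<close> by simp
    then have "\<zeta> s \<omega> = \<zeta> t0 \<omega>" if "t0 \<le> s" for s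
    proof (cases "s = t0 \<or> s < b")
      case True
      then show ?thesis using that b(2)[of s] by (cases "s = t0") simp_all
    next
      case False
      then have "t < s" using t(2) by simp
      then show ?thesis using t(1) \<open>\<zeta> t \<omega> = \<zeta> t0 \<omega>\<close> by simp
    qed
    with t0 show ?thesis by blast
  qed
  show ?thesis
  proof (intro set_eqI iffI)
    fix \<omega> assume "\<omega> \<in> consensus_event M \<zeta>"
    then have \<omega>: "\<omega> \<in> space M" "fixation_time \<zeta> \<omega> < \<infinity>"
      and c: "\<exists>c. \<forall>x. \<zeta> (real_of_ereal (fixation_time \<zeta> \<omega>)) \<omega> x = c"
      by (auto simp: consensus_event_def)
    obtain t0 where t0: "fixation_time \<zeta> \<omega> = ereal t0" "0 \<le> t0" "\<forall>s\<ge>t0. \<zeta> s \<omega> = \<zeta> t0 \<omega>"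
      using attained[OF \<omega>] by blast
    obtain c where "\<zeta> t0 \<omega> = (\<lambda>_. c)" using c t0(1) by auto
    with t0 \<omega>(1) show "\<omega> \<in> {\<omega> \<in> space M. \<exists>t\<ge>0. \<exists>c. \<forall>s\<ge>t. \<zeta> s \<omega> = (\<lambda>_. c)}" by auto
  next
    fix \<omega> assume "\<omega> \<in> {\<omega> \<in> space M. \<exists>t\<ge>0. \<exists>c. \<forall>s\<ge>t. \<zeta> s \<omega> = (\<lambda>_. c)}"
    then obtain t c where \<omega>: "\<omega> \<in> space M" and t: "0 \<le> t" "\<And>s. t \<le> s \<Longrightarrow> \<zeta> s \<omega> = (\<lambda>_. c)" by auto
    have "fixation_time \<zeta> \<omega> \<le> ereal t"
      unfolding fixation_time_def using t by (intro Inf_lower) auto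
    then have le: "fixation_time \<zeta> \<omega> < \<infinity>" by (rule le_less_trans) simp
    obtain t0 where t0: "fixation_time \<zeta> \<omega> = ereal t0" "0 \<le> t0" "\<forall>s\<ge>t0. \<zeta> s \<omega> = \<zeta> t0 \<omega>"
      using attained[OF \<omega> le] by blast
    have "\<zeta> (max t0 t) \<omega> = \<zeta> t0 \<omega>" by (rule t0(3)[rule_format]) simp
    moreover have "\<zeta> (max t0 t) \<omega> = (\<lambda>_. c)" by (rule t(2)) simp
    ultimately have "\<zeta> t0 \<omega> = (\<lambda>_. c)" by simp
    with \<omega> le t0(1) show "\<omega> \<in> consensus_event M \<zeta>" by (simp add: consensus_event_def)
  qed
qed

text \<open>By right-continuity the values at rational times determine the path, so countably many
  measurable conditions suffice.\<close>

lemma consensus_event_sets: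
  fixes \<zeta> :: "real \<Rightarrow> 'w \<Rightarrow> 'v::finite \<Rightarrow> 'a::finite"
  assumes rc: "\<And>\<omega> t. \<omega> \<in> space M \<Longrightarrow> 0 \<le> t \<Longrightarrow> (\<forall>\<^sub>F s in at_right t. \<zeta> s \<omega> = \<zeta> t \<omega>)"
    and m: "\<And>t. 0 \<le> t \<Longrightarrow> \<zeta> t \<in> M \<rightarrow>\<^sub>M count_space UNIV"
  shows "consensus_event M \<zeta> \<in> sets M"
proof -
  have "consensus_event M \<zeta> = {\<omega> \<in> space M. \<exists>n::nat. \<exists>c. \<forall>q\<in>\<rat> \<inter> {real n..}. \<zeta> q \<omega> = (\<lambda>_. c)}"
  proof (subst consensus_event_eq, rule rc, assumption, assumption, intro set_eqI iffI)
    fix \<omega> assume "\<omega> \<in> {\<omega> \<in> space M. \<exists>t\<ge>0. \<exists>c. \<forall>s\<ge>t. \<zeta> s \<omega> = (\<lambda>_. c)}"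
    then obtain t c where \<omega>: "\<omega> \<in> space M" and t: "\<And>s. t \<le> s \<Longrightarrow> \<zeta> s \<omega> = (\<lambda>_. c)" by auto
    obtain n :: nat where "t \<le> real n" using real_arch_simple by blast
    then have "\<forall>q\<in>\<rat> \<inter> {real n..}. \<zeta> q \<omega> = (\<lambda>_. c)" using t by auto
    with \<omega> show "\<omega> \<in> {\<omega> \<in> space M. \<exists>n::nat. \<exists>c. \<forall>q\<in>\<rat> \<inter> {real n..}. \<zeta> q \<omega> = (\<lambda>_. c)}" by blast
  next
    fix \<omega> assume "\<omega> \<in> {\<omega> \<in> space M. \<exists>n::nat. \<exists>c. \<forall>q\<in>\<rat> \<inter> {real n..}. \<zeta> q \<omega> = (\<lambda>_. c)}"
    then obtain n :: nat and c where \<omega>: "\<omega> \<in> space M"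
      and q: "\<And>q. q \<in> \<rat> \<Longrightarrow> real n \<le> q \<Longrightarrow> \<zeta> q \<omega> = (\<lambda>_. c)" by auto
    have "\<zeta> s \<omega> = (\<lambda>_. c)" if s: "real n \<le> s" for s
    proof -
      have "0 \<le> s" using s by linarith
      then obtain b where b: "s < b" "\<And>r. s < r \<Longrightarrow> r < b \<Longrightarrow> \<zeta> r \<omega> = \<zeta> s \<omega>"
        using rc[OF \<omega>, of s] by (auto simp: eventually_at_right_field)
      obtain r where "r \<in> \<rat>" "s < r" "r < b" using Rats_dense_in_real[OF b(1)] by blast
      then show ?thesis using b(2)[of r] q[of r] s by simp
    qed
    then show "\<omega> \<in> {\<omega> \<in> space M. \<exists>t\<ge>0. \<exists>c. \<forall>s\<ge>t. \<zeta> s \<omega> = (\<lambda>_. c)}"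
      using \<omega> by (intro CollectI conjI exI[of _ "real n"] exI[of _ c]) auto
  qed
  also have "\<dots> \<in> sets M"
  proof (intro sets.sets_Collect_countable_Ex sets.sets_Collect_countable_All')
    show "countable (\<rat> \<inter> {real n..})" for n
      using countable_rat by (rule countable_subset[rotated]) simp
  next
    fix n :: nat and c and q :: real assume "q \<in> \<rat> \<inter> {real n..}"
    then have "0 \<le> q" by (auto intro: order_trans[OF of_nat_0_le_iff])
    from measurable_sets[OF m[OF this], of "{\<lambda>_. c}"]
    have "\<zeta> q -` {\<lambda>_. c} \<inter> space M \<in> sets M" by simp
    also have "\<zeta> q -` {\<lambda>_. c} \<inter> space M = {\<omega> \<in> space M. \<zeta> q \<omega> = (\<lambda>_. c)}" by auto
    finally show "{\<omega> \<in> space M. \<zeta> q \<omega> = (\<lambda>_. c)} \<in> sets M" .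
  qed
  finally show ?thesis .
qed

lemma (in prob_space) integral_finite_type:
  fixes f :: "'b::finite \<Rightarrow> real"
  assumes Z: "Z \<in> M \<rightarrow>\<^sub>M count_space UNIV"
  shows "integrable M (\<lambda>\<omega>. f (Z \<omega>))"
    and "(\<integral>\<omega>. f (Z \<omega>) \<partial>M) = (\<Sum>b\<in>UNIV. measure M {\<omega> \<in> space M. Z \<omega> = b} * f b)"
proof -
  have s: "{\<omega> \<in> space M. Z \<omega> = b} \<in> sets M" for b
  proof -
    have "Z -` {b} \<inter> space M \<in> sets M" using Z by (rule measurable_sets) simp
    also have "Z -` {b} \<inter> space M = {\<omega> \<in> space M. Z \<omega> = b}" by auto
    finally show ?thesis .
  qed
  have eq: "f (Z \<omega>) = (\<Sum>b\<in>UNIV. f b * indicator {\<omega> \<in> space M. Z \<omega> = b} \<omega>)" if "\<omega> \<in> space M" for \<omega>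
  proof -
    have "(\<Sum>b\<in>UNIV. f b * indicator {\<omega> \<in> space M. Z \<omega> = b} \<omega>) = (\<Sum>b\<in>UNIV. if b = Z \<omega> then f b else 0)"
      using that by (intro sum.cong) (auto split: split_indicator)
    then show ?thesis by simp
  qed
  have i: "integrable M (\<lambda>\<omega>. f b * indicator {\<omega> \<in> space M. Z \<omega> = b} \<omega>)" for b
    using s by (intro integrable_mult_right integrable_real_indicator) (auto simp: emeasure_eq_measure)
  have "integrable M (\<lambda>\<omega>. \<Sum>b\<in>UNIV. f b * indicator {\<omega> \<in> space M. Z \<omega> = b} \<omega>)"
    by (intro Bochner_Integration.integrable_sum i)
  also have "?this \<longleftrightarrow> integrable M (\<lambda>\<omega>. f (Z \<omega>))"
    by (intro Bochner_Integration.integrable_cong refl eq[symmetric])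
  finally show "integrable M (\<lambda>\<omega>. f (Z \<omega>))" .
  have "(\<integral>\<omega>. f (Z \<omega>) \<partial>M) = (\<integral>\<omega>. (\<Sum>b\<in>UNIV. f b * indicator {\<omega> \<in> space M. Z \<omega> = b} \<omega>) \<partial>M)"
    by (intro Bochner_Integration.integral_cong refl eq)
  also have "\<dots> = (\<Sum>b\<in>UNIV. \<integral>\<omega>. f b * indicator {\<omega> \<in> space M. Z \<omega> = b} \<omega> \<partial>M)"
    using i by (intro Bochner_Integration.integral_sum)
  also have "\<dots> = (\<Sum>b\<in>UNIV. measure M {\<omega> \<in> space M. Z \<omega> = b} * f b)"
    using s by (intro sum.cong) (simp_all add: Int_absorb2)
  finally show "(\<integral>\<omega>. f (Z \<omega>) \<partial>M) = (\<Sum>b\<in>UNIV. measure M {\<omega> \<in> space M. Z \<omega> = b} * f b)" .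
qed

section \<open>Reduction of a random start to a deterministic one\<close>

context attraction_process
begin

definition initial_coded :: "(('v \<times> 'v) source) \<Rightarrow> 'w \<Rightarrow> real" where
  "initial_coded = coded (\<lambda>\<omega>. real (to_nat (\<zeta> 0 \<omega>))) gap choice"

text \<open>\<open>std_exponential\<close> is the default outside the index set:
  \<open>product_law\<close> wants a probability law at every index, and \<open>source_law\<close>
  fixes the clock laws even for pairs outside \<open>S\<close>.\<close>

definition source_distr :: "(('v \<times> 'v) source) \<Rightarrow> real measure" where
  "source_distr i = (if i \<in> insert Initial (sources S) then distr M borel (initial_coded i) else std_exponential)"

lemma initial_coded_measurable:
  assumes "i \<in> insert Initial (sources S)"
  shows "initial_coded i \<in> borel_measurable M"
proof (cases i)
  case Initial
  have "(\<lambda>\<omega>. real (to_nat (\<zeta> 0 \<omega>))) \<in> borel_measurable M"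
    by (rule measurable_compose[OF measurable_process[OF order_refl]]) simp
  then show ?thesis using Initial by (simp add: initial_coded_def)
next
  case (Clock e n)
  then have "gap e n \<in> borel_measurable M"
    using distributed_measurable[OF gap_distributed[of e n]] assms by simp
  then show ?thesis using Clock by (simp add: initial_coded_def)
next
  case (Choice e n)
  have "(\<lambda>\<omega>. real (to_nat (choice e n \<omega>))) \<in> borel_measurable M"
    using Choice assms by (intro measurable_compose[OF measurable_choice]) auto
  then show ?thesis using Choice by (simp add: initial_coded_def)
qed

text \<open>A coded variable is a function of its source, so its preimages belong to the
  sigma-algebra of that source and the assumed independence gives the product formula.\<close>

lemma initial_product_law: "product_law M initial_coded source_distr (insert Initial (sources S))"
  unfolding product_law_def
proof (intro conjI allI impI ballI)
  show "prob_space M" by (rule prob_space_axioms)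
  show "prob_space (source_distr i)" for i
    using prob_space_std_exponential initial_coded_measurable
    by (simp add: source_distr_def prob_space_distr)
  show "sets (source_distr i) = sets borel" for i
    by (simp add: source_distr_def)
  show "initial_coded i \<in> borel_measurable M" if "i \<in> insert Initial (sources S)" for i
    using that by (rule initial_coded_measurable)
  fix J A assume J: "finite J" "J \<subseteq> insert Initial (sources S)" "\<forall>i\<in>J. A i \<in> sets (borel :: real measure)"
  show "measure M {\<omega> \<in> space M. \<forall>i\<in>J. initial_coded i \<omega> \<in> A i} = (\<Prod>i\<in>J. measure (source_distr i) (A i))"
  proof (cases "J = {}")
    case False
    let ?X = "\<lambda>i. initial_coded i -` A i \<inter> space M"
    have "{\<omega> \<in> space M. \<forall>i\<in>J. initial_coded i \<omega> \<in> A i} = (\<Inter>i\<in>J. ?X i)" using False by auto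
    also have "measure M \<dots> = (\<Prod>i\<in>J. measure M (?X i))"
    proof (rule indep_setsD[OF independence _ False J(1)])
      show "J \<subseteq> {Initial} \<union> {Clock e n |e n. e \<in> S} \<union> {Choice e n |e n. e \<in> S}"
        using J(2) unfolding sources_def by blast
      show "\<forall>i\<in>J. ?X i \<in> (case i of
          Initial \<Rightarrow> sets (vimage_algebra (space M) (\<zeta> 0) (count_space UNIV))
        | Clock e n \<Rightarrow> sets (vimage_algebra (space M) (gap e n) borel)
        | Choice e n \<Rightarrow> sets (vimage_algebra (space M) (choice e n) (count_space UNIV)))"
      proof
        fix i assume i: "i \<in> J"
        show "?X i \<in> (case i of
          Initial \<Rightarrow> sets (vimage_algebra (space M) (\<zeta> 0) (count_space UNIV))
        | Clock e n \<Rightarrow> sets (vimage_algebra (space M) (gap e n) borel)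
        | Choice e n \<Rightarrow> sets (vimage_algebra (space M) (choice e n) (count_space UNIV)))"
        proof (cases i)
          case Initial
          have "?X i = \<zeta> 0 -` {\<eta>. real (to_nat \<eta>) \<in> A i} \<inter> space M"
            using Initial by (auto simp: initial_coded_def)
          also have "\<dots> \<in> sets (vimage_algebra (space M) (\<zeta> 0) (count_space UNIV))"
            by (rule in_vimage_algebra) simp
          finally show ?thesis using Initial by simp
        next
          case (Clock e n)
          have "?X i = gap e n -` A i \<inter> space M"
            using Clock by (auto simp: initial_coded_def)
          also have "\<dots> \<in> sets (vimage_algebra (space M) (gap e n) borel)"
            using J(3) i by (intro in_vimage_algebra) simp
          finally show ?thesis using Clock by simp
        next
          case (Choice e n)
          have "?X i = choice e n -` {c. real (to_nat c) \<in> A i} \<inter> space M"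
            using Choice by (auto simp: initial_coded_def)
          also have "\<dots> \<in> sets (vimage_algebra (space M) (choice e n) (count_space UNIV))"
            by (rule in_vimage_algebra) simp
          finally show ?thesis using Choice by simp
        qed
      qed
    qed
    also have "\<dots> = (\<Prod>i\<in>J. measure (source_distr i) (A i))"
    proof (rule prod.cong[OF refl])
      fix i assume "i \<in> J"
      then have i: "i \<in> insert Initial (sources S)" "A i \<in> sets borel" using J by auto
      then show "measure M (?X i) = measure (source_distr i) (A i)"
        unfolding source_distr_def by (simp only: if_True measure_distr[OF initial_coded_measurable[OF i(1)] i(2)])
    qed
    finally show ?thesis .
  qed (simp add: prob_space)
qed

text \<open>\<open>to_nat\<close> is injective, so the mass at a code is the probability of a single
  choice function, and sums of such masses are probabilities of sets of choice functions. The
  marginals then come from \<open>choice_uniform\<close>.\<close>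

lemma source_law_source_distr: "source_law S E source_distr"
  unfolding source_law_def
proof (intro conjI allI ballI impI)
  fix e n
  show "source_distr (Clock e n) = std_exponential"
  proof (cases "e \<in> S")
    case True
    have "distr M borel (initial_coded (Clock e n)) = distr M lborel (gap e n)"
      by (rule distr_cong) (simp_all add: initial_coded_def)
    also have "\<dots> = std_exponential"
      by (rule distributed_distr_eq_density[OF gap_distributed[OF True]])
    finally show ?thesis using True by (simp add: source_distr_def)
  qed (simp add: source_distr_def)
next
  fix e n assume e: "e \<in> S"
  let ?C = "distr M (count_space UNIV) (choice e n)"
  interpret C: prob_space ?C by (intro prob_space_distr measurable_choice e)
  have p: "measure (source_distr (Choice e n)) {real (to_nat c)} = measure ?C {c}" for c
  proof -
    have i: "Choice e n \<in> insert Initial (sources S)" using e by simp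
    have "measure (source_distr (Choice e n)) {real (to_nat c)} =
        measure M (initial_coded (Choice e n) -` {real (to_nat c)} \<inter> space M)"
      unfolding source_distr_def if_P[OF i] by (intro measure_distr initial_coded_measurable i) simp
    also have "\<dots> = measure M (choice e n -` {c} \<inter> space M)"
      by (intro arg_cong[where f="measure M"]) (auto simp: initial_coded_def)
    also have "\<dots> = measure ?C {c}"
      by (intro measure_distr[symmetric] measurable_choice e) simp
    finally show ?thesis .
  qed
  have sum: "(\<Sum>c\<in>Q. measure (source_distr (Choice e n)) {real (to_nat c)}) = measure ?C Q" for Q
    unfolding p by (rule C.finite_measure_eq_sum_singleton[symmetric]) auto
  show "(\<Sum>c\<in>UNIV. measure (source_distr (Choice e n)) {real (to_nat (c :: 'a \<Rightarrow> 'a \<Rightarrow> 'a))}) = 1"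
    unfolding sum using C.prob_space by simp
  fix a b a' :: 'a assume ab: "a \<noteq> b"
  have "measure ?C {c. c a b = a'} = measure M (choice e n -` {c. c a b = a'} \<inter> space M)"
    by (intro measure_distr measurable_choice e) simp
  also have "\<dots> = measure M ((\<lambda>\<omega>. choice e n \<omega> a b) -` {a'} \<inter> space M)"
    by (intro arg_cong[where f="measure M"]) auto
  also have "\<dots> = measure (distr M (count_space UNIV) (\<lambda>\<omega>. choice e n \<omega> a b)) {a'}"
    by (intro measure_distr[symmetric] measurable_compose[OF measurable_choice[OF e]]) simp_all
  also have "\<dots> = pmf (pmf_of_set (toward E a b)) a'"
    unfolding choice_uniform[OF e ab] by (simp add: measure_pmf_single)
  finally show "(\<Sum>c | c a b = a'. measure (source_distr (Choice e n)) {real (to_nat (c :: 'a \<Rightarrow> 'a \<Rightarrow> 'a))}) =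
      pmf (pmf_of_set (toward E a b)) a'"
    unfolding sum .
qed

lemma consensus_event_M_eq:
  "consensus_event M \<zeta> = {\<omega> \<in> space M. \<exists>t\<ge>0. \<exists>c. \<forall>s\<ge>t. \<zeta> s \<omega> = (\<lambda>_. c)}"
  by (rule consensus_event_eq) (rule right_continuous)

lemma consensus_event_sets_M: "consensus_event M \<zeta> \<in> sets M"
  by (rule consensus_event_sets) (rule right_continuous measurable_process; assumption)+

text \<open>The initial configuration is independent of clocks and choices, so conditioning on its
  value leaves their law unchanged and makes the start deterministic.\<close>

lemma attraction_system_initial:
  assumes pos: "measure M {\<omega> \<in> space M. \<zeta> 0 \<omega> = \<eta>} > 0"
  shows "attraction_system (uniform_measure M {\<omega> \<in> space M. \<zeta> 0 \<omega> = \<eta>}) S E \<tau> gap choice \<zeta> \<eta>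
    (consensus_event M \<zeta>)"
proof -
  let ?C = "{\<omega> \<in> space M. \<zeta> 0 \<omega> = \<eta>}" and ?I = "insert Initial (sources S)"
  have C: "?C = {\<omega> \<in> space M. initial_coded Initial \<omega> \<in> {real (to_nat \<eta>)}}"
    by (auto simp: initial_coded_def)
  \<comment> \<open>A set outside \<open>sets M\<close> would have measure 0.\<close>
  have Cs: "?C \<in> sets M" using pos measure_notin_sets by fastforce
  have "product_law (uniform_measure M ?C) initial_coded source_distr (?I - {Initial})"
    using pos unfolding C by (intro product_law_condition[OF initial_product_law]) auto
  moreover have "?I - {Initial} = sources S" by auto
  ultimately have "product_law (uniform_measure M ?C) initial_coded source_distr (sources S)" by simp
  then have P: "product_law (uniform_measure M ?C) (coded (\<lambda>_. 0) gap choice) source_distr (sources S)"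
  proof (rule product_law_cong)
    fix i \<omega> assume "i \<in> sources S"
    then show "initial_coded i \<omega> = coded (\<lambda>_. 0) gap choice i \<omega>"
      by (cases i) (simp_all add: initial_coded_def)
  qed
  show ?thesis
    unfolding attraction_system_def
  proof (intro conjI)
    show "\<exists>D. product_law (uniform_measure M ?C) (coded (\<lambda>_. 0) gap choice) D (sources S) \<and> source_law S E D"
      using P source_law_source_distr by blast
    show "consensus_event M \<zeta> \<in> sets (uniform_measure M ?C)"
      using consensus_event_sets_M by simp
    show "\<forall>\<omega>\<in>space (uniform_measure M ?C). (\<exists>t\<ge>0. \<exists>c. \<forall>s\<ge>t. \<zeta> s \<omega> = (\<lambda>_. c)) \<longrightarrow> \<omega> \<in> consensus_event M \<zeta>"
      unfolding consensus_event_M_eq by simp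
    show "AE \<omega> in uniform_measure M ?C. \<zeta> 0 \<omega> = \<eta>"
      by (rule AE_uniform_measureI[OF Cs]) simp
    show "AE \<omega> in uniform_measure M ?C. evolves S E \<tau> gap choice \<zeta> \<omega>"
    proof (rule AE_uniform_measureI[OF Cs])
      show "AE \<omega> in M. \<omega> \<in> ?C \<longrightarrow> evolves S E \<tau> gap choice \<zeta> \<omega>"
        using evolution unfolding evolves_def[symmetric] by (rule AE_mp) simp
    qed
  qed
qed

text \<open>Total probability over the finitely many initial configurations: the deterministic bound
  applies to each one of positive probability.\<close>

lemma consensus_probability_bound:
  assumes "connected_graph S" "connected_graph E" "graph_radius E \<le> \<tau>" "eccentricity_inequalities E"
  shows "(\<integral>\<omega>. consensus_bound E \<tau> (\<zeta> 0 \<omega>) \<partial>M) \<le> measure M (consensus_event M \<zeta>)"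
proof -
  let ?K = "consensus_event M \<zeta>" and ?C = "\<lambda>\<eta>. {\<omega> \<in> space M. \<zeta> 0 \<omega> = \<eta>}"
  have m0: "\<zeta> 0 \<in> M \<rightarrow>\<^sub>M count_space UNIV" by (rule measurable_process) simp
  note K = consensus_event_sets_M
  have Cs: "?C \<eta> \<in> sets M" for \<eta>
  proof -
    have "\<zeta> 0 -` {\<eta>} \<inter> space M \<in> sets M" using m0 by (rule measurable_sets) simp
    also have "\<zeta> 0 -` {\<eta>} \<inter> space M = ?C \<eta>" by auto
    finally show ?thesis .
  qed
  have "(\<integral>\<omega>. consensus_bound E \<tau> (\<zeta> 0 \<omega>) \<partial>M) = (\<Sum>\<eta>\<in>UNIV. measure M (?C \<eta>) * consensus_bound E \<tau> \<eta>)"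
    by (rule integral_finite_type[OF m0])
  also have "\<dots> \<le> (\<Sum>\<eta>\<in>UNIV. measure M (?C \<eta> \<inter> ?K))"
  proof (rule sum_mono)
    fix \<eta>
    show "measure M (?C \<eta>) * consensus_bound E \<tau> \<eta> \<le> measure M (?C \<eta> \<inter> ?K)"
    proof (cases "measure M (?C \<eta>) > 0")
      case True
      then have e0: "emeasure M (?C \<eta>) \<noteq> 0" "emeasure M (?C \<eta>) \<noteq> \<infinity>"
        by (auto simp: emeasure_eq_measure)
      have "consensus_bound E \<tau> \<eta> \<le> measure (uniform_measure M (?C \<eta>)) ?K"
        by (rule system_lower_bound[OF assms attraction_system_initial[OF True]])
      also have "\<dots> = measure M (?C \<eta> \<inter> ?K) / measure M (?C \<eta>)"
        by (rule measure_uniform_measure[OF e0 K])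
      finally show ?thesis using True by (simp add: field_simps)
    next
      case False
      then have "measure M (?C \<eta>) = 0" by (simp add: zero_less_measure_iff)
      then show ?thesis by simp
    qed
  qed
  also have "\<dots> \<le> measure M ?K"
    using K Cs by (intro sum_partition_measure_le prob_space_axioms) (auto simp: disjoint_family_on_def)
  finally show ?thesis .
qed

end

theorem theorem3:
  fixes M :: "'w measure"
    and S :: "('v::finite \<times> 'v) set"
    and E :: "('a::finite \<times> 'a) set"
    and \<tau> :: nat
    and gap :: "'v \<times> 'v \<Rightarrow> nat \<Rightarrow> 'w \<Rightarrow> real"
    and choice :: "'v \<times> 'v \<Rightarrow> nat \<Rightarrow> 'w \<Rightarrow> 'a \<Rightarrow> 'a \<Rightarrow> 'a"
    and \<zeta> :: "real \<Rightarrow> 'w \<Rightarrow> 'v \<Rightarrow> 'a"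
  assumes "connected_graph S"
    and "connected_graph E"
    and "attraction_process M S E \<tau> gap choice \<zeta>"
    and "graph_radius E \<le> \<tau>"
    and "\<tau> < graph_diameter E"
    and "eccentricity_inequalities E"
  shows "measure M (consensus_event M \<zeta>) \<ge>
      1 - 1 / real CARD('v) * (\<Sum>x\<in>UNIV.
        ((\<integral>\<omega>. real (ecc E (\<zeta> 0 \<omega> x)) \<partial>M) - real (graph_radius E)) /
          (real \<tau> + 1 - real (graph_radius E)))
    \<and> (uniform_product_initial M \<zeta> \<longrightarrow>
      measure M (consensus_event M \<zeta>) \<ge>
      1 - 1 / real CARD('a) * (\<Sum>a\<in>UNIV.
        (real (ecc E a) - real (graph_radius E)) /
          (real \<tau> + 1 - real (graph_radius E))))"
proof -
  interpret attraction_process M S E \<tau> gap choice \<zeta> by fact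
  let ?w = "real \<tau> + 1 - real (graph_radius E)"
  have m0: "\<zeta> 0 \<in> M \<rightarrow>\<^sub>M count_space UNIV" by (rule measurable_process) simp
  have int: "integrable M (\<lambda>\<omega>. real (ecc E (\<zeta> 0 \<omega> x)))" for x
    by (rule integral_finite_type(1)[OF m0])
  \<comment> \<open>The bound is affine in the eccentricities, so the expectation passes through the
    sum.\<close>
  have "(\<integral>\<omega>. consensus_bound E \<tau> (\<zeta> 0 \<omega>) \<partial>M) = 1 - 1 / real CARD('v) * (\<Sum>x\<in>UNIV.
      ((\<integral>\<omega>. real (ecc E (\<zeta> 0 \<omega> x)) \<partial>M) - real (graph_radius E)) / ?w)"
    unfolding consensus_bound_def using int by (simp add: prob_space)
  with consensus_probability_bound[OF assms(1,2,4,6)]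
  have main: "measure M (consensus_event M \<zeta>) \<ge> 1 - 1 / real CARD('v) * (\<Sum>x\<in>UNIV.
      ((\<integral>\<omega>. real (ecc E (\<zeta> 0 \<omega> x)) \<partial>M) - real (graph_radius E)) / ?w)"
    by simp
  have eq: "1 / real CARD('v) * (\<Sum>x\<in>UNIV.
      ((\<integral>\<omega>. real (ecc E (\<zeta> 0 \<omega> x)) \<partial>M) - real (graph_radius E)) / ?w) =
      1 / real CARD('a) * (\<Sum>a\<in>UNIV. (real (ecc E a) - real (graph_radius E)) / ?w)"
    if unif: "uniform_product_initial M \<zeta>"
  proof -
    \<comment> \<open>Every vertex has the same mean eccentricity, so averaging over the vertices
      reproduces that single value.\<close>
    have "(\<integral>\<omega>. real (ecc E (\<zeta> 0 \<omega> x)) \<partial>M) = (\<Sum>a\<in>UNIV. real (ecc E a)) / real CARD('a)" for x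
    proof -
      have mx: "(\<lambda>\<omega>. \<zeta> 0 \<omega> x) \<in> M \<rightarrow>\<^sub>M count_space UNIV"
        by (rule measurable_compose[OF m0]) simp
      have "(\<integral>\<omega>. real (ecc E (\<zeta> 0 \<omega> x)) \<partial>M) =
          (\<integral>a. real (ecc E a) \<partial>distr M (count_space UNIV) (\<lambda>\<omega>. \<zeta> 0 \<omega> x))"
        by (rule integral_distr[OF mx, symmetric]) simp
      also have "distr M (count_space UNIV) (\<lambda>\<omega>. \<zeta> 0 \<omega> x) = measure_pmf (pmf_of_set UNIV)"
        using unif by (simp add: uniform_product_initial_def)
      also have "(\<integral>a. real (ecc E a) \<partial>measure_pmf (pmf_of_set UNIV)) = (\<Sum>a\<in>UNIV. real (ecc E a)) / real CARD('a)"
        by (rule integral_pmf_of_set) auto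
      finally show ?thesis .
    qed
    then show ?thesis
      by (simp add: sum_subtractf sum_divide_distrib[symmetric] diff_divide_distrib)
  qed
  show ?thesis
  proof (intro conjI impI main)
    assume "uniform_product_initial M \<zeta>"
    with main show "measure M (consensus_event M \<zeta>) \<ge>
        1 - 1 / real CARD('a) * (\<Sum>a\<in>UNIV. (real (ecc E a) - real (graph_radius E)) / ?w)"
      by (simp only: eq)
  qed
qed

end
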